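(* Let $\Theta\subset\mathbb{R}^m$ be open, let $M=\mathbb{R}^d$, and let $T_\theta:M\to M$ ($\theta\in\Theta$) be a family of invertible maps, smooth in $\theta$ and in $x$. Let $p\in\mathcal{P}$ be a reference probability measure on $M$ with positive density, assume $\int|T_\theta(x)|^2\,dp(x)<\infty$ for all $\theta\in\Theta$, let $\rho_\theta$ be the density of $(T_\theta)_{\#}p$, and let $\mathcal{P}_\Theta=\{\rho_\theta:\theta\in\Theta\}\subset\mathcal{P}$. Equip $\Theta$ with the pullback $G=(T_{\#})^*g^W$ of the Wasserstein metric under the isometric immersion $T_{\#}:\theta\mapsto\rho_\theta$. Let $\beta>0$, $V:\mathbb{R}^d\to\mathbb{R}$, let $$\mathcal{F}(\rho)=\int V(x)\rho(x)\,dx+\beta\int\rho(x)\log\rho(x)\,dx$$ be the relative entropy, and let $F(\theta)=\mathcal{F}(\rho_\theta)$. Suppose $\{\theta_t\}_{t\ge0}$ solves $$\dot\theta=-G(\theta)^{-1}\nabla_\theta F(\theta).$$ Then $\{\rho_{\theta_t}\}_{t\ge0}$ is the gradient flow of $\mathcal{F}$ on the probability submanifold $\mathcal{P}_\Theta$, i.e. $\frac{\partial}{\partial t}\rho_{\theta_t}=-\mathrm{grad}\,\mathcal{F}(\rho_{\theta_t})|_{\mathcal{P}_\Theta}$.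
   Context: $\mathcal{P}=\{\rho:\int_{\mathbb{R}^d}\rho(x)\,dx=1,\ \rho\ge0,\ \int|x|^2\rho(x)\,dx<\infty\}$ is the space of probability densities on $\mathbb{R}^d$ with finite second moment, with tangent space $T_\rho\mathcal{P}=\{\dot\rho:\int\dot\rho\,dx=0\}$. The Wasserstein metric tensor is $$g^W(\rho)(\dot\rho_1,\dot\rho_2)=\int\nabla\psi_1(x)\cdot\nabla\psi_2(x)\,\rho(x)\,dx,\qquad \dot\rho_i=-\nabla\cdot(\rho\nabla\psi_i),\ i=1,2$$ (divergence equations in the weak sense, with potentials of finite energy $\int|\nabla\psi|^2\rho\,dx<\infty$). For $\xi\in T_\theta\Theta\simeq\mathbb{R}^m$, the pushforward tangent vector $(T_{\#}|_\theta)_*\xi\in T_{\rho_\theta}\mathcal{P}$ is $\frac{\partial}{\partial t}\rho_{\theta_t}\big|_{t=0}$ (weak sense) for any differentiable curve $\theta_t$ in $\Theta$ with $\theta_0=\theta$, $\dot\theta_0=\xi$. The pullback metric is $G(\theta)(\xi,\eta)=g^W(\rho_\theta)\big((T_{\#}|_\theta)_*\xi,(T_{\#}|_\theta)_*\eta\big)=\xi^TG(\theta)\eta$, identified with an $m\times m$ matrix, assumed invertible so that the ODE makes sense. The submanifold $\mathcal{P}_\Theta$ has tangent space $T_{\rho_\theta}\mathcal{P}_\Theta=\{(T_{\#}|_\theta)_*\xi:\xi\in\mathbb{R}^m\}$ and carries the restriction of $g^W$. The gradient $\mathrm{grad}\,\mathcal{F}(\rho_\theta)|_{\mathcal{P}_\Theta}$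 is the Riemannian gradient on this submanifold: the element $\eta\in T_{\rho_\theta}\mathcal{P}_\Theta$ such that $g^W(\rho_\theta)(\eta,(T_{\#}|_\theta)_*\xi)=\frac{d}{ds}\mathcal{F}(\rho_{\theta+s\xi})\big|_{s=0}$ for all $\xi\in\mathbb{R}^m$. As is implicit in the ODE, $F$ is finite and differentiable on $\Theta$. For a measurable map $T$ and a measure $\lambda$, $T_{\#}\lambda(E)=\lambda(T^{-1}(E))$. *)

theory Defs
  imports "HOL-Analysis.Analysis"
begin

text \<open>For open \<open>S\<close> in a finite-dimensional space, \<open>C_on n S f\<close> says that \<open>f\<close> is of class
  \<open>C\<^sup>n\<close> on \<open>S\<close>: all iterated directional derivatives up to order \<open>n\<close> exist and are continuous.\<close>

primrec C_on :: "nat \<Rightarrow> 'a::real_normed_vector set \<Rightarrow> ('a \<Rightarrow> 'b::real_normed_vector) \<Rightarrow> bool" where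
  "C_on 0 S f \<longleftrightarrow> continuous_on S f"
| "C_on (Suc n) S f \<longleftrightarrow>
     (\<forall>x\<in>S. f differentiable (at x)) \<and> (\<forall>v. C_on n S (\<lambda>x. frechet_derivative f (at x) v))"

definition smooth_on :: "'a::real_normed_vector set \<Rightarrow> ('a \<Rightarrow> 'b::real_normed_vector) \<Rightarrow> bool" where
  "smooth_on S f \<longleftrightarrow> (\<forall>n. C_on n S f)"

definition gradient :: "('a::real_inner \<Rightarrow> real) \<Rightarrow> 'a \<Rightarrow> 'a" where
  "gradient f x = (THE D. GDERIV f x :> D)"

definition test_functions :: "('a::euclidean_space \<Rightarrow> real) set" where
  "test_functions = {\<phi>. smooth_on UNIV \<phi> \<and> compact (closure {x. \<phi> x \<noteq> 0})}"

definition prob_densities :: "('a::euclidean_space \<Rightarrow> real) set" where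
  "prob_densities = {\<rho>. \<rho> \<in> borel_measurable borel \<and> (\<forall>x. 0 \<le> \<rho> x)
     \<and> integrable lborel \<rho> \<and> (\<integral>x. \<rho> x \<partial>lborel) = 1
     \<and> integrable lborel (\<lambda>x. (norm x)\<^sup>2 * \<rho> x)}"

text \<open>Since time derivatives and divergences of densities are taken in the weak sense, a tangent
  vector is represented by the linear functional \<open>\<phi> \<mapsto> \<integral>\<phi> \<rho>'\<close> on test functions.
  Functionals are set to \<open>0\<close> outside the test functions, so that two of them are equal as HOL
  functions iff they agree on test functions.\<close>

definition test_functionals :: "(('a::euclidean_space \<Rightarrow> real) \<Rightarrow> real) set" where
  "test_functionals = {D. (\<forall>\<phi>. \<phi> \<notin> test_functions \<longrightarrow> D \<phi> = 0)
     \<and> (\<forall>\<phi>\<in>test_functions. \<forall>\<zeta>\<in>test_functions. \<forall>a b.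
          D (\<lambda>x. a * \<phi> x + b * \<zeta> x) = a * D \<phi> + b * D \<zeta>)}"

text \<open>The condition \<open>\<integral>\<rho>' dx = 0\<close> for functionals: \<open>D\<close> vanishes in the limit on cutoff functions
  exhausting the space. If \<open>D\<close> is integration against an integrable function, then the limit is the
  integral of that function.\<close>

definition tangent_space :: "(('a::euclidean_space \<Rightarrow> real) \<Rightarrow> real) set" where
  "tangent_space = {D \<in> test_functionals.
     \<forall>\<zeta>\<in>test_functions. (\<forall>\<^sub>F x in nhds 0. \<zeta> x = 1) \<longrightarrow>
       ((\<lambda>R. D (\<lambda>x. \<zeta> (x /\<^sub>R R))) \<longlongrightarrow> 0) at_top}"

definition has_weak_derivative ::
    "(real \<Rightarrow> 'a::euclidean_space \<Rightarrow> real) \<Rightarrow> (('a \<Rightarrow> real) \<Rightarrow> real) \<Rightarrow> real filter \<Rightarrow> bool" where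
  "has_weak_derivative r D F \<longleftrightarrow> D \<in> test_functionals \<and>
     (\<forall>\<phi>\<in>test_functions. ((\<lambda>s. \<integral>x. \<phi> x * r s x \<partial>lborel) has_real_derivative D \<phi>) F)"

text \<open>\<open>\<psi>\<close> is a potential of finite energy and \<open>u = \<nabla>\<psi>\<close> is its gradient in the weighted Sobolev
  sense, that is, as a limit of smooth compactly supported potentials with respect to the energy
  \<open>\<integral>\<bar>\<nabla>\<psi>\<bar>\<^sup>2 \<rho>\<close>. For a probability density \<open>\<rho>\<close>, every continuously differentiable \<open>\<psi>\<close> with
  \<open>\<integral>\<bar>\<nabla>\<psi>\<bar>\<^sup>2 \<rho> < \<infinity>\<close> is such a potential, with \<open>u\<close> its classical gradient (truncate \<open>\<psi>\<close>,
  cut off and mollify). For irregular \<open>\<rho>\<close>, locally integrable distributional gradients would not do: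
  they can violate the uniqueness of \<open>\<nabla>\<psi>\<close> on which the metric depends.\<close>

definition finite_energy_gradient ::
    "('a::euclidean_space \<Rightarrow> real) \<Rightarrow> ('a \<Rightarrow> real) \<Rightarrow> ('a \<Rightarrow> 'a) \<Rightarrow> bool" where
  "finite_energy_gradient \<rho> \<psi> u \<longleftrightarrow>
     \<psi> \<in> borel_measurable borel \<and> u \<in> borel_measurable borel
     \<and> integrable lborel (\<lambda>x. (norm (u x))\<^sup>2 * \<rho> x)
     \<and> (\<exists>\<phi>. (\<forall>n. \<phi> n \<in> test_functions)
          \<and> (AE x in lborel. 0 < \<rho> x \<longrightarrow> (\<lambda>n. \<phi> n x) \<longlonglongrightarrow> \<psi> x)
          \<and> (\<lambda>n. \<integral>x. (norm (gradient (\<phi> n) x - u x))\<^sup>2 * \<rho> x \<partial>lborel) \<longlonglongrightarrow> 0)"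

text \<open>The weak form of \<open>D = - \<nabla>\<cdot>(\<rho> \<nabla>\<psi>)\<close>, with \<open>u = \<nabla>\<psi>\<close>.\<close>

definition wasserstein_potential ::
    "('a::euclidean_space \<Rightarrow> real) \<Rightarrow> (('a \<Rightarrow> real) \<Rightarrow> real) \<Rightarrow> ('a \<Rightarrow> real) \<Rightarrow> ('a \<Rightarrow> 'a) \<Rightarrow> bool" where
  "wasserstein_potential \<rho> D \<psi> u \<longleftrightarrow> finite_energy_gradient \<rho> \<psi> u \<and>
     (\<forall>\<phi>\<in>test_functions. D \<phi> = (\<integral>x. (gradient \<phi> x \<bullet> u x) * \<rho> x \<partial>lborel))"

text \<open>The tangent vectors at \<open>\<rho>\<close> on which the Wasserstein metric is finite.\<close>

definition wasserstein_tangent_space ::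
    "('a::euclidean_space \<Rightarrow> real) \<Rightarrow> (('a \<Rightarrow> real) \<Rightarrow> real) set" where
  "wasserstein_tangent_space \<rho> = {D \<in> tangent_space. \<exists>\<psi> u. wasserstein_potential \<rho> D \<psi> u}"

definition wasserstein_metric ::
    "('a::euclidean_space \<Rightarrow> real) \<Rightarrow> (('a \<Rightarrow> real) \<Rightarrow> real) \<Rightarrow> (('a \<Rightarrow> real) \<Rightarrow> real) \<Rightarrow> real" where
  "wasserstein_metric \<rho> D1 D2 = (THE c. \<exists>\<psi>1 u1 \<psi>2 u2.
     wasserstein_potential \<rho> D1 \<psi>1 u1 \<and> wasserstein_potential \<rho> D2 \<psi>2 u2
     \<and> c = (\<integral>x. (u1 x \<bullet> u2 x) * \<rho> x \<partial>lborel))"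

text \<open>In what follows, \<open>\<rho> \<theta>\<close> is the density with parameter \<open>\<theta> \<in> \<Theta>\<close>. The tangent vector
  \<open>(T\<^sub>#)\<^sub>* \<xi>\<close> at \<open>\<theta>\<close> is the common weak derivative of \<open>\<rho>\<close> along all differentiable curves in
  \<open>\<Theta>\<close> through \<open>\<theta>\<close> with velocity \<open>\<xi>\<close>.\<close>

definition pushforward_tangent ::
    "'p::real_normed_vector set \<Rightarrow> ('p \<Rightarrow> 'a::euclidean_space \<Rightarrow> real) \<Rightarrow> 'p \<Rightarrow> 'p
      \<Rightarrow> ('a \<Rightarrow> real) \<Rightarrow> real" where
  "pushforward_tangent \<Theta> \<rho> \<theta> \<xi> = (THE D. \<forall>\<gamma> \<epsilon>. 0 < \<epsilon>
     \<and> (\<forall>t\<in>{-\<epsilon><..<\<epsilon>}. \<gamma> t \<in> \<Theta> \<and> \<gamma> differentiable (at t))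
     \<and> \<gamma> 0 = \<theta> \<and> (\<gamma> has_vector_derivative \<xi>) (at 0)
     \<longrightarrow> has_weak_derivative (\<lambda>t. \<rho> (\<gamma> t)) D (at 0))"

definition pullback_metric ::
    "'p::real_normed_vector set \<Rightarrow> ('p \<Rightarrow> 'a::euclidean_space \<Rightarrow> real) \<Rightarrow> 'p \<Rightarrow> 'p \<Rightarrow> 'p \<Rightarrow> real" where
  "pullback_metric \<Theta> \<rho> \<theta> \<xi> \<eta> =
     wasserstein_metric (\<rho> \<theta>) (pushforward_tangent \<Theta> \<rho> \<theta> \<xi>) (pushforward_tangent \<Theta> \<rho> \<theta> \<eta>)"

definition metric_matrix ::
    "(real^'m) set \<Rightarrow> (real^'m \<Rightarrow> 'a::euclidean_space \<Rightarrow> real) \<Rightarrow> real^'m \<Rightarrow> real^'m^'m" where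
  "metric_matrix \<Theta> \<rho> \<theta> = (\<chi> i j. pullback_metric \<Theta> \<rho> \<theta> (axis i 1) (axis j 1))"

definition submanifold_tangent_space ::
    "'p::real_normed_vector set \<Rightarrow> ('p \<Rightarrow> 'a::euclidean_space \<Rightarrow> real) \<Rightarrow> 'p
      \<Rightarrow> (('a \<Rightarrow> real) \<Rightarrow> real) set" where
  "submanifold_tangent_space \<Theta> \<rho> \<theta> = range (pushforward_tangent \<Theta> \<rho> \<theta>)"

definition is_submanifold_gradient ::
    "'p::real_normed_vector set \<Rightarrow> ('p \<Rightarrow> 'a::euclidean_space \<Rightarrow> real) \<Rightarrow> (('a \<Rightarrow> real) \<Rightarrow> real)
      \<Rightarrow> 'p \<Rightarrow> (('a \<Rightarrow> real) \<Rightarrow> real) \<Rightarrow> bool" where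
  "is_submanifold_gradient \<Theta> \<rho> E \<theta> \<eta> \<longleftrightarrow> \<eta> \<in> submanifold_tangent_space \<Theta> \<rho> \<theta> \<and>
     (\<forall>\<xi>. ((\<lambda>s. E (\<rho> (\<theta> + s *\<^sub>R \<xi>))) has_real_derivative
            wasserstein_metric (\<rho> \<theta>) \<eta> (pushforward_tangent \<Theta> \<rho> \<theta> \<xi>)) (at 0))"

definition submanifold_gradient ::
    "'p::real_normed_vector set \<Rightarrow> ('p \<Rightarrow> 'a::euclidean_space \<Rightarrow> real) \<Rightarrow> (('a \<Rightarrow> real) \<Rightarrow> real)
      \<Rightarrow> 'p \<Rightarrow> ('a \<Rightarrow> real) \<Rightarrow> real" where
  "submanifold_gradient \<Theta> \<rho> E \<theta> = (THE \<eta>. is_submanifold_gradient \<Theta> \<rho> E \<theta> \<eta>)"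

definition relative_entropy ::
    "('a::euclidean_space \<Rightarrow> real) \<Rightarrow> real \<Rightarrow> ('a \<Rightarrow> real) \<Rightarrow> real" where
  "relative_entropy V \<beta> \<rho> =
     (\<integral>x. V x * \<rho> x \<partial>lborel) + \<beta> * (\<integral>x. \<rho> x * ln (\<rho> x) \<partial>lborel)"

end

theory Submission
  imports Defs
begin

text \<open>For a test function \<open>\<phi>\<close> the map \<open>\<theta> \<mapsto> \<integral> \<phi> \<rho>\<^sub>\<theta> = \<integral> \<phi> \<circ> T\<^sub>\<theta> dp\<close> is differentiable, by dominated
  convergence. Hence \<open>(T\<^sub>#)\<^sub>* \<xi>\<close> exists, is linear in \<open>\<xi>\<close>, and is the weak derivative of \<open>\<rho>\<close> along every
  curve with velocity \<open>\<xi>\<close>, one-sided derivatives included. The potential gradients of a tangent vector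
  are unique \<open>\<rho>\<close>-almost everywhere, so the Wasserstein metric is a well-defined symmetric bilinear
  form and the pullback metric is given by the matrix \<open>G\<close>. Then \<open>(T\<^sub>#)\<^sub>* \<zeta>\<close> is the gradient on the
  submanifold iff \<open>\<xi> \<bullet> G \<zeta> = \<xi> \<bullet> \<nabla>F\<close> for all \<open>\<xi>\<close>, that is, iff \<open>\<zeta> = G\<^sup>-\<^sup>1 \<nabla>F\<close>.\<close>

section \<open>Test functions\<close>

text \<open>Induction on the order: the directional derivative of a combination is the same
  combination of directional derivatives. The functions must vary in the induction, because the
  hypothesis is applied to these derivatives.\<close>

lemma C_on_linear_combination:
  fixes f g :: "'a::real_normed_vector \<Rightarrow> 'b::real_normed_vector"
  assumes "C_on n UNIV f" "C_on n UNIV g"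
  shows "C_on n UNIV (\<lambda>x. a *\<^sub>R f x + b *\<^sub>R g x)"
  using assms
proof (induction n arbitrary: f g)
  case 0
  then show ?case by (auto intro!: continuous_intros)
next
  case (Suc n)
  have deriv: "((\<lambda>x. a *\<^sub>R f x + b *\<^sub>R g x) has_derivative
      (\<lambda>v. a *\<^sub>R frechet_derivative f (at x) v + b *\<^sub>R frechet_derivative g (at x) v)) (at x)" for x
    using Suc.prems by (auto intro!: derivative_intros simp: frechet_derivative_works[symmetric])
  show ?case
    using Suc deriv frechet_derivative_at[OF deriv, symmetric]
    by (auto simp: differentiable_def)
qed

lemma test_functions_linear_combination:
  assumes "\<phi> \<in> test_functions" "\<zeta> \<in> test_functions"
  shows "(\<lambda>x. a * \<phi> x + b * \<zeta> x) \<in> test_functions"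
proof -
  have "smooth_on UNIV (\<lambda>x. a * \<phi> x + b * \<zeta> x)"
    using assms C_on_linear_combination[of _ \<phi> \<zeta> a b]
    by (auto simp: test_functions_def smooth_on_def)
  moreover have "compact (closure {x. a * \<phi> x + b * \<zeta> x \<noteq> 0})"
  proof (rule compact_closure[THEN iffD2], rule bounded_subset)
    show "bounded ({x. \<phi> x \<noteq> 0} \<union> {x. \<zeta> x \<noteq> 0})"
      using assms by (auto simp: test_functions_def)
  qed auto
  ultimately show ?thesis by (simp add: test_functions_def)
qed

text \<open>The Riesz representation in coordinates: a linear functional is the inner product with
  the vector whose coordinates are its values on the basis.\<close>

lemma has_derivative_imp_GDERIV:
  fixes f :: "'a::euclidean_space \<Rightarrow> real"
  assumes "(f has_derivative f') (at x)"
  shows "GDERIV f x :> (\<Sum>b\<in>Basis. f' b *\<^sub>R b)"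
proof -
  have "f' = (\<lambda>h. h \<bullet> (\<Sum>b\<in>Basis. f' b *\<^sub>R b))"
  proof
    fix h
    have "f' h = f' (\<Sum>b\<in>Basis. (h \<bullet> b) *\<^sub>R b)"
      by (simp add: euclidean_representation)
    also have "\<dots> = (\<Sum>b\<in>Basis. (h \<bullet> b) * f' b)"
      using has_derivative_linear[OF assms] by (simp add: linear_sum linear_cmul)
    finally show "f' h = h \<bullet> (\<Sum>b\<in>Basis. f' b *\<^sub>R b)"
      by (simp add: inner_sum_right mult.commute)
  qed
  then show ?thesis using assms by (simp add: gderiv_def)
qed

text \<open>This resolves the definite description in \<open>gradient\<close>: derivatives are
  unique, and a vector is determined by its inner products with all others.\<close>

lemma gradient_eqI:
  fixes f :: "'a::real_inner \<Rightarrow> real"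
  assumes "GDERIV f x :> D"
  shows "gradient f x = D"
  unfolding gradient_def
proof (rule the_equality[where P="\<lambda>D. GDERIV f x :> D", OF assms])
  fix D' assume "GDERIV f x :> D'"
  then have "(\<lambda>h. h \<bullet> D') = (\<lambda>h. h \<bullet> D)"
    using assms has_derivative_unique unfolding gderiv_def by blast
  then show "D' = D"
    by (metis inner_commute vector_eq_rdot)
qed

lemma GDERIV_gradient:
  fixes f :: "'a::euclidean_space \<Rightarrow> real"
  assumes "f differentiable (at x)"
  shows "GDERIV f x :> gradient f x"
  using assms has_derivative_imp_GDERIV gradient_eqI unfolding differentiable_def by metis

lemma test_function_differentiable:
  assumes "\<phi> \<in> test_functions"
  shows "\<phi> differentiable (at x)"
  using assms C_on.simps(2)[of 0 UNIV \<phi>] unfolding test_functions_def smooth_on_def by blast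

lemma test_function_has_derivative:
  assumes "\<phi> \<in> test_functions"
  shows "(\<phi> has_derivative (\<lambda>h. h \<bullet> gradient \<phi> x)) (at x)"
  using GDERIV_gradient[OF test_function_differentiable[OF assms]] unfolding gderiv_def .

lemma test_function_continuous:
  assumes "\<phi> \<in> test_functions"
  shows "continuous_on S \<phi>"
  by (meson assms continuous_at_imp_continuous_on differentiable_imp_continuous_within
      test_function_differentiable)

lemma test_function_measurable:
  assumes "\<phi> \<in> test_functions"
  shows "\<phi> \<in> borel_measurable borel"
  using test_function_continuous[OF assms] by (rule borel_measurable_continuous_onI)

lemma gradient_linear_combination:
  assumes "\<phi> \<in> test_functions" "\<zeta> \<in> test_functions"
  shows "gradient (\<lambda>x. a * \<phi> x + b * \<zeta> x) x = a *\<^sub>R gradient \<phi> x + b *\<^sub>R gradient \<zeta> x"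
proof (rule gradient_eqI, unfold gderiv_def)
  have "((\<lambda>x. a * \<phi> x + b * \<zeta> x) has_derivative
      (\<lambda>h. a * (h \<bullet> gradient \<phi> x) + b * (h \<bullet> gradient \<zeta> x))) (at x)"
    by (intro has_derivative_add has_derivative_mult_right test_function_has_derivative assms)
  then show "((\<lambda>x. a * \<phi> x + b * \<zeta> x) has_derivative
      (\<lambda>h. h \<bullet> (a *\<^sub>R gradient \<phi> x + b *\<^sub>R gradient \<zeta> x))) (at x)"
    by (simp add: inner_add_right)
qed

text \<open>The coordinates of the gradient are directional derivatives, which \<open>C_on 1\<close>
  makes continuous.\<close>

lemma test_function_gradient_continuous:
  assumes "\<phi> \<in> test_functions"
  shows "continuous_on S (gradient \<phi>)"
proof -
  have "continuous_on UNIV (\<lambda>x. frechet_derivative \<phi> (at x) v)" for v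
    using assms C_on.simps(2)[of 0 UNIV \<phi>] unfolding test_functions_def smooth_on_def C_on.simps(1)
    by blast
  then have "continuous_on S (\<lambda>x. frechet_derivative \<phi> (at x) v)" for v
    using continuous_on_subset by blast
  then have "continuous_on S (\<lambda>x. \<Sum>b\<in>Basis. frechet_derivative \<phi> (at x) b *\<^sub>R b)"
    by (intro continuous_on_sum continuous_on_scaleR continuous_on_const)
  moreover have "gradient \<phi> x = (\<Sum>b\<in>Basis. frechet_derivative \<phi> (at x) b *\<^sub>R b)" for x
    using test_function_differentiable[OF assms, of x]
    unfolding frechet_derivative_works by (intro gradient_eqI has_derivative_imp_GDERIV)
  ultimately show ?thesis
    by simp
qed

section \<open>Global bounds from compact support\<close>

lemma compactly_supported_bounded:
  fixes f :: "'a::metric_space \<Rightarrow> 'b::real_normed_vector"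
  assumes "continuous_on UNIV f" "compact K" "\<And>x. x \<notin> K \<Longrightarrow> f x = 0"
  obtains M where "0 \<le> M" "\<And>x. norm (f x) \<le> M"
proof -
  obtain M where "0 \<le> M" "\<And>x. x \<in> K \<Longrightarrow> norm (f x) \<le> M"
    using continuous_on_compact_bound[OF assms(2) continuous_on_subset[OF assms(1) subset_UNIV]] by blast
  then show ?thesis
    using that assms(3) by (metis norm_zero)
qed

lemma test_function_support:
  assumes "x \<notin> closure {x. \<phi> x \<noteq> 0}"
  shows "\<phi> x = 0"
  using assms closure_subset[of "{x. \<phi> x \<noteq> 0}"] by auto

lemma test_function_bounded:
  assumes "\<phi> \<in> test_functions"
  obtains M where "0 \<le> M" "\<And>x. norm (\<phi> x) \<le> M"
proof (rule compactly_supported_bounded[where f=\<phi>])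
  show "compact (closure {x. \<phi> x \<noteq> 0})"
    using assms by (simp add: test_functions_def)
  show "continuous_on UNIV \<phi>"
    using assms by (rule test_function_continuous)
qed (blast intro: test_function_support)+

lemma test_function_gradient_bounded:
  assumes "\<phi> \<in> test_functions"
  obtains M where "0 \<le> M" "\<And>x. norm (gradient \<phi> x) \<le> M"
proof (rule compactly_supported_bounded)
  show "continuous_on UNIV (gradient \<phi>)"
    by (rule test_function_gradient_continuous[OF assms])
  show "compact (closure {x. \<phi> x \<noteq> 0})"
    using assms by (simp add: test_functions_def)
next
  fix x assume x: "x \<notin> closure {x. \<phi> x \<noteq> 0}"
  have "((\<lambda>x. 0::real) has_derivative (\<lambda>h. 0)) (at x)"
    by simp
  then have "(\<phi> has_derivative (\<lambda>h. 0)) (at x)"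
    \<comment> \<open>The complement of the closed support is open, so the function agrees with zero
      on a whole neighbourhood of the point.\<close>
    by (rule has_derivative_transform_within_open[where s="- closure {x. \<phi> x \<noteq> 0}"])
      (use x test_function_support[of _ \<phi>, symmetric] in blast)+
  then have "GDERIV \<phi> x :> 0" by (simp add: gderiv_def)
  then show "gradient \<phi> x = 0" by (rule gradient_eqI)
qed blast

text \<open>The mean value inequality on the whole space, with the uniform bound on the gradient as
  Lipschitz constant.\<close>

lemma test_function_lipschitz:
  assumes "\<phi> \<in> test_functions"
  obtains M where "0 \<le> M" "\<And>x y. \<bar>\<phi> x - \<phi> y\<bar> \<le> M * norm (x - y)"
proof -
  obtain M where M: "0 \<le> M" "\<And>x. norm (gradient \<phi> x) \<le> M"
    using test_function_gradient_bounded[OF assms] by blast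
  have "norm (\<phi> x - \<phi> y) \<le> M * norm (x - y)" for x y
  proof (rule differentiable_bound[where S=UNIV])
    show "(\<phi> has_derivative (\<lambda>h. h \<bullet> gradient \<phi> x)) (at x within UNIV)" for x
      using test_function_has_derivative[OF assms] .
    show "onorm (\<lambda>h. h \<bullet> gradient \<phi> x) \<le> M" for x
    proof (rule onorm_bound[OF M(1)])
      fix h
      have "norm (h \<bullet> gradient \<phi> x) \<le> norm h * norm (gradient \<phi> x)"
        by (simp add: Cauchy_Schwarz_ineq2)
      also have "\<dots> \<le> norm h * M" by (intro mult_left_mono M) auto
      finally show "norm (h \<bullet> gradient \<phi> x) \<le> M * norm h" by (simp add: mult.commute)
    qed
  qed auto
  then show ?thesis using that[OF M(1)] by auto
qed

section \<open>Differentiation under the integral sign\<close>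

text \<open>Dominated convergence applied to the remainder quotient of the Frechet derivative.
  Increments are only compared with the value at \<open>x\<close>, and the measurability of
  \<open>f'\<close> in \<open>z\<close> is derived rather than assumed.\<close>

lemma has_derivative_integral:
  fixes f :: "'p::euclidean_space \<Rightarrow> 'a \<Rightarrow> real"
  assumes "0 < r"
    and int: "\<And>y. dist y x < r \<Longrightarrow> integrable M (f y)"
    and w: "integrable M w"
    and lip: "\<And>y z. dist y x < r \<Longrightarrow> \<bar>f y z - f x z\<bar> \<le> w z * norm (y - x)"
    and deriv: "\<And>z. ((\<lambda>y. f y z) has_derivative f' z) (at x)"
  shows "((\<lambda>y. \<integral>z. f y z \<partial>M) has_derivative (\<lambda>h. \<integral>z. f' z h \<partial>M)) (at x)"
proof -
  have lin: "linear (f' z)" for z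
    using deriv has_derivative_linear by blast
  \<comment> \<open>Writing \<open>f' z h\<close> as a sequential limit of difference quotients
    serves two purposes below: a bound on it and its measurability.\<close>
  have quot: "(\<lambda>n. (f (x + inverse (real (Suc n)) *\<^sub>R h) z - f x z) * real (Suc n)) \<longlonglongrightarrow> f' z h" for h z
  proof -
    have "((\<lambda>t. x + t *\<^sub>R h) has_derivative (\<lambda>t. t *\<^sub>R h)) (at 0)"
      by (auto intro!: derivative_eq_intros)
    moreover have "((\<lambda>y. f y z) has_derivative f' z) (at (x + 0 *\<^sub>R h))"
      using deriv by simp
    ultimately have "((\<lambda>t. f (x + t *\<^sub>R h) z) has_derivative (\<lambda>t. f' z (t *\<^sub>R h))) (at 0)"
      by (rule has_derivative_compose)
    then have "((\<lambda>t. f (x + t *\<^sub>R h) z) has_real_derivative f' z h) (at 0)"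
      by (simp add: has_field_derivative_def linear_cmul[OF lin] mult_commute_abs)
    then have "((\<lambda>t. (f (x + t *\<^sub>R h) z - f x z) / t) \<longlongrightarrow> f' z h) (at 0)"
      by (simp add: has_field_derivative_iff)
    from filterlim_compose[OF this, of "\<lambda>n. inverse (real (Suc n))" sequentially]
    have "(\<lambda>n. (f (x + inverse (real (Suc n)) *\<^sub>R h) z - f x z) / inverse (real (Suc n))) \<longlonglongrightarrow> f' z h"
      by (simp add: filterlim_at LIMSEQ_inverse_real_of_nat del: of_nat_Suc)
    then show ?thesis by (simp add: divide_inverse del: of_nat_Suc)
  qed
  have near: "\<forall>\<^sub>F n in sequentially. dist (x + inverse (real (Suc n)) *\<^sub>R h) x < r" for h
  proof -
    have "(\<lambda>n. x + inverse (real (Suc n)) *\<^sub>R h) \<longlonglongrightarrow> x + 0 *\<^sub>R h"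
      by (intro tendsto_intros LIMSEQ_inverse_real_of_nat)
    from tendstoD[OF this \<open>0 < r\<close>] show ?thesis by simp
  qed
  \<comment> \<open>The Lipschitz estimate passes to the limit of the quotients. It holds for every
    \<open>h\<close>, since the scaled increments eventually enter the ball of radius
    \<open>r\<close>.\<close>
  have bound: "\<bar>f' z h\<bar> \<le> w z * norm h" for z h
  proof (rule tendsto_upperbound)
    show "(\<lambda>n. \<bar>(f (x + inverse (real (Suc n)) *\<^sub>R h) z - f x z) * real (Suc n)\<bar>) \<longlonglongrightarrow> \<bar>f' z h\<bar>"
      by (intro tendsto_intros quot)
    show "\<forall>\<^sub>F n in sequentially. \<bar>(f (x + inverse (real (Suc n)) *\<^sub>R h) z - f x z) * real (Suc n)\<bar> \<le> w z * norm h"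
      using near[of h]
    proof eventually_elim
      case (elim n)
      let ?y = "x + inverse (real (Suc n)) *\<^sub>R h"
      have "\<bar>f ?y z - f x z\<bar> * real (Suc n) \<le> w z * norm (?y - x) * real (Suc n)"
        using lip[OF elim] by (rule mult_right_mono) simp
      also have "\<dots> = w z * norm h"
        by simp
      finally show ?case
        by (simp add: abs_mult)
    qed
  qed simp
  have meas[measurable]: "(\<lambda>z. f' z h) \<in> borel_measurable M" for h
  proof -
    obtain N where N: "\<And>n. N \<le> n \<Longrightarrow> dist (x + inverse (real (Suc n)) *\<^sub>R h) x < r"
      using near[of h] unfolding eventually_sequentially by blast
    show ?thesis
    proof (rule borel_measurable_LIMSEQ_real)
      \<comment> \<open>The shift by \<open>N\<close> keeps all the points in the ball where
        \<open>f\<close> is known to be integrable, hence measurable.\<close>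
      show "(\<lambda>n. (f (x + inverse (real (Suc (n + N))) *\<^sub>R h) z - f x z) * real (Suc (n + N))) \<longlonglongrightarrow> f' z h" for z
        using LIMSEQ_ignore_initial_segment[OF quot, where k=N] .
      have [measurable]: "f x \<in> borel_measurable M"
        "f (x + inverse (real (Suc (n + N))) *\<^sub>R h) \<in> borel_measurable M" for n
        using int[of x] int[OF N[of "n + N"]] \<open>0 < r\<close> by auto
      show "(\<lambda>z. (f (x + inverse (real (Suc (n + N))) *\<^sub>R h) z - f x z) * real (Suc (n + N))) \<in> borel_measurable M" for n
        by measurable
    qed
  qed
  have wpos: "0 \<le> w z" for z
  proof -
    \<comment> \<open>A unit vector turns \<open>bound\<close> into a lower bound for
      \<open>w z\<close>.\<close>
    obtain b :: 'p where "b \<in> Basis" using nonempty_Basis by blast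
    then show ?thesis using bound[of z b] abs_ge_zero[of "f' z b"] by simp
  qed
  have int': "integrable M (\<lambda>z. f' z h)" for h
    by (rule Bochner_Integration.integrable_bound[of M "\<lambda>z. w z * norm h"])
      (use w wpos bound in auto)
  have linI: "linear (\<lambda>h. \<integral>z. f' z h \<partial>M)"
    by (rule linearI) (simp_all add: linear_add[OF lin] linear_cmul[OF lin] int')
  show ?thesis
    unfolding has_derivative_iff_norm
  proof (intro conjI)
    show "bounded_linear (\<lambda>h. \<integral>z. f' z h \<partial>M)"
      using linI linear_conv_bounded_linear by blast
    show "((\<lambda>y. norm ((\<integral>z. f y z \<partial>M) - (\<integral>z. f x z \<partial>M) - (\<integral>z. f' z (y - x) \<partial>M)) / norm (y - x)) \<longlongrightarrow> 0) (at x)"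
      unfolding tendsto_at_iff_sequentially
    proof (intro allI impI)
      fix X :: "nat \<Rightarrow> 'p" assume X: "\<forall>i. X i \<in> UNIV - {x}" "X \<longlonglongrightarrow> x"
      then obtain N where N: "\<And>n. N \<le> n \<Longrightarrow> dist (X n) x < r"
        using metric_LIMSEQ_D[of X x r] \<open>0 < r\<close> by blast
      \<comment> \<open>The remainder quotient tends to zero pointwise by differentiability. It is
        dominated by \<open>2 * w z\<close>, one copy of \<open>w\<close> coming from the increment
        of \<open>f\<close> and one from the derivative.\<close>
      define Q where "Q n z = (f (X (n + N)) z - f x z - f' z (X (n + N) - x)) / norm (X (n + N) - x)" for n z
      have [measurable]: "f x \<in> borel_measurable M" "f (X (n + N)) \<in> borel_measurable M" for n
        using int[of x] int[OF N[of "n + N"]] \<open>0 < r\<close> by auto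
      have "(\<lambda>n. \<integral>z. Q n z \<partial>M) \<longlonglongrightarrow> (\<integral>z. 0 \<partial>M)"
      proof (rule integral_dominated_convergence)
        show "integrable M (\<lambda>z. 2 * w z)" using w by simp
        show "AE z in M. (\<lambda>n. Q n z) \<longlonglongrightarrow> 0"
        proof (rule AE_I2)
          fix z
          have "((\<lambda>y. norm (f y z - f x z - f' z (y - x)) / norm (y - x)) \<longlongrightarrow> 0) (at x)"
            using deriv[of z] unfolding has_derivative_iff_norm by blast
          then have "(\<lambda>n. norm (f (X n) z - f x z - f' z (X n - x)) / norm (X n - x)) \<longlonglongrightarrow> 0"
            using X unfolding tendsto_at_iff_sequentially comp_def by blast
          from LIMSEQ_ignore_initial_segment[OF this, where k=N]
          have "(\<lambda>n. \<bar>Q n z\<bar>) \<longlonglongrightarrow> 0"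
            by (simp add: Q_def)
          then show "(\<lambda>n. Q n z) \<longlonglongrightarrow> 0"
            by (rule tendsto_rabs_zero_cancel)
        qed
        show "AE z in M. norm (Q n z) \<le> 2 * w z" for n
        proof (rule AE_I2)
          fix z
          have "\<bar>f (X (n + N)) z - f x z - f' z (X (n + N) - x)\<bar> \<le> 2 * w z * norm (X (n + N) - x)"
            using lip[OF N[of "n + N"], of z] bound[of z "X (n + N) - x"] by auto
          moreover have "norm (X (n + N) - x) > 0" using X by auto
          ultimately show "norm (Q n z) \<le> 2 * w z"
            by (simp add: Q_def field_simps)
        qed
      qed (auto simp: Q_def)
      moreover have "\<bar>\<integral>z. Q n z \<partial>M\<bar> = norm ((\<integral>z. f (X (n + N)) z \<partial>M) - (\<integral>z. f x z \<partial>M)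
          - (\<integral>z. f' z (X (n + N) - x) \<partial>M)) / norm (X (n + N) - x)" for n
        using int[of x] int[OF N[of "n + N"]] int'[of "X (n + N) - x"] \<open>0 < r\<close>
        by (simp add: Q_def)
      ultimately have "(\<lambda>n. ((\<lambda>y. norm ((\<integral>z. f y z \<partial>M) - (\<integral>z. f x z \<partial>M)
          - (\<integral>z. f' z (y - x) \<partial>M)) / norm (y - x)) \<circ> X) (n + N)) \<longlonglongrightarrow> 0"
        using tendsto_rabs_zero[of "\<lambda>n. \<integral>z. Q n z \<partial>M"] by simp
      then show "((\<lambda>y. norm ((\<integral>z. f y z \<partial>M) - (\<integral>z. f x z \<partial>M) - (\<integral>z. f' z (y - x) \<partial>M)) / norm (y - x)) \<circ> X) \<longlonglongrightarrow> 0"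
        by (rule LIMSEQ_offset[where k=N])
    qed
  qed
qed

section \<open>Push-forwards under a smooth family of bijections\<close>

lemma smooth_on_differentiable:
  assumes "smooth_on S f" "x \<in> S"
  shows "f differentiable (at x)"
  using assms C_on.simps(2)[of 0 S f] unfolding smooth_on_def by blast

lemma smooth_on_continuous:
  assumes "smooth_on S f"
  shows "continuous_on S f"
  using assms C_on.simps(1) unfolding smooth_on_def by blast

text \<open>The operator norm is at most the sum of the norms of the values on the basis. That sum
  is continuous in the point, hence bounded on a compact set.\<close>

lemma smooth_on_derivative_bounded:
  fixes f :: "'a::euclidean_space \<Rightarrow> 'b::real_normed_vector"
  assumes f: "smooth_on S f" and C: "compact C" "C \<subseteq> S"
  obtains M where "0 \<le> M" "\<And>x. x \<in> C \<Longrightarrow> onorm (frechet_derivative f (at x)) \<le> M"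
proof -
  define g where "g x = (\<Sum>b\<in>Basis. norm (frechet_derivative f (at x) b))" for x
  have "continuous_on S (\<lambda>x. frechet_derivative f (at x) v)" for v
    using f C_on.simps(2)[of 0 S f] unfolding smooth_on_def C_on.simps(1) by blast
  then have "continuous_on C (\<lambda>x. frechet_derivative f (at x) v)" for v
    using C(2) continuous_on_subset by blast
  then have "continuous_on C g"
    unfolding g_def by (intro continuous_on_sum continuous_on_norm)
  then obtain M where M: "0 \<le> M" "\<And>x. x \<in> C \<Longrightarrow> norm (g x) \<le> M"
    using continuous_on_compact_bound[OF C(1)] by blast
  have "onorm (frechet_derivative f (at x)) \<le> M" if x: "x \<in> C" for x
  proof -
    have "f differentiable (at x)"
      using f x C(2) smooth_on_differentiable by blast
    then have "onorm (frechet_derivative f (at x)) \<le> g x"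
      unfolding g_def frechet_derivative_works
      by (intro onorm_componentwise has_derivative_bounded_linear)
    then show ?thesis
      using M(2)[OF x] by simp
  qed
  then show ?thesis
    using that M(1) by blast
qed

text \<open>Real derivatives determine the functional on test functions; elsewhere both functionals
  take the default value zero.\<close>

lemma has_weak_derivative_unique:
  assumes "has_weak_derivative r D (at t)" "has_weak_derivative r D' (at t)"
  shows "D = D'"
proof
  fix \<phi>
  show "D \<phi> = D' \<phi>"
    using assms DERIV_unique unfolding has_weak_derivative_def test_functionals_def
    by (cases "\<phi> \<in> test_functions") (blast, simp)
qed

text \<open>The parameters range over any Euclidean space here: coordinates only enter later, with
  the matrix of the pullback metric.\<close>

locale pushforward_family =
  fixes \<Theta> :: "'p::euclidean_space set"
    and T :: "'p \<Rightarrow> 'a::euclidean_space \<Rightarrow> 'a"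
    and p :: "'a \<Rightarrow> real"
    and \<rho> :: "'p \<Rightarrow> 'a \<Rightarrow> real"
  assumes open_params: "open \<Theta>"
    and T_bij: "\<And>\<theta>. \<theta> \<in> \<Theta> \<Longrightarrow> bij (T \<theta>)"
    and T_smooth: "smooth_on (\<Theta> \<times> UNIV) (\<lambda>(\<theta>, x). T \<theta> x)"
    and p_density: "p \<in> prob_densities"
    and \<rho>_meas: "\<And>\<theta>. \<theta> \<in> \<Theta> \<Longrightarrow> \<rho> \<theta> \<in> borel_measurable borel"
    and \<rho>_nonneg: "\<And>\<theta> x. \<theta> \<in> \<Theta> \<Longrightarrow> 0 \<le> \<rho> \<theta> x"
    and \<rho>_push: "\<And>\<theta>. \<theta> \<in> \<Theta> \<Longrightarrow>
          distr (density lborel (\<lambda>x. ennreal (p x))) borel (T \<theta>) = density lborel (\<lambda>x. ennreal (\<rho> \<theta> x))"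
begin

abbreviation \<mu> :: "'a measure" where
  "\<mu> \<equiv> density lborel (\<lambda>x. ennreal (p x))"

lemma integrable_const_\<mu>: "integrable \<mu> (\<lambda>x. c::real)"
proof -
  have "integrable lborel (\<lambda>x. p x *\<^sub>R c)" "p \<in> borel_measurable lborel" "AE x in lborel. 0 \<le> p x"
    using p_density by (auto simp: prob_densities_def)
  then show ?thesis by (subst integrable_density) auto
qed

lemma T_measurable:
  assumes "\<theta> \<in> \<Theta>"
  shows "T \<theta> \<in> borel_measurable borel"
proof (rule borel_measurable_continuous_onI)
  have "continuous_on ({\<theta>} \<times> UNIV) (\<lambda>(\<theta>, x). T \<theta> x)"
    using smooth_on_continuous[OF T_smooth] assms by (auto elim: continuous_on_subset)
  then have "continuous_on UNIV ((\<lambda>(\<theta>, x). T \<theta> x) \<circ> (\<lambda>x. (\<theta>, x)))"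
    by (intro continuous_on_compose continuous_intros) (auto elim: continuous_on_subset)
  then show "continuous_on UNIV (T \<theta>)"
    by (simp add: comp_def)
qed

text \<open>Change of variables. It moves the dependence on the parameter from the density, about
  whose regularity in the parameter nothing is assumed, to the smooth map inside an integral over
  the fixed measure \<open>\<mu>\<close>.\<close>

lemma
  fixes f :: "'a \<Rightarrow> real"
  assumes \<theta>: "\<theta> \<in> \<Theta>" and f: "f \<in> borel_measurable borel"
  shows integral_push: "(\<integral>x. f x * \<rho> \<theta> x \<partial>lborel) = (\<integral>x. f (T \<theta> x) \<partial>\<mu>)"
    and integrable_push: "integrable lborel (\<lambda>x. f x * \<rho> \<theta> x) \<longleftrightarrow> integrable \<mu> (\<lambda>x. f (T \<theta> x))"
proof -
  have T: "T \<theta> \<in> measurable \<mu> borel"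
    using T_measurable[OF \<theta>] by simp
  have \<rho>: "\<rho> \<theta> \<in> borel_measurable lborel" "AE x in lborel. 0 \<le> \<rho> \<theta> x" "f \<in> borel_measurable lborel"
    using \<rho>_meas[OF \<theta>] \<rho>_nonneg[OF \<theta>] f by auto
  show "(\<integral>x. f x * \<rho> \<theta> x \<partial>lborel) = (\<integral>x. f (T \<theta> x) \<partial>\<mu>)"
    using integral_distr[OF T f] integral_density[OF \<rho>(3) \<rho>(1,2)]
    by (simp add: \<rho>_push[OF \<theta>] mult.commute)
  show "integrable lborel (\<lambda>x. f x * \<rho> \<theta> x) \<longleftrightarrow> integrable \<mu> (\<lambda>x. f (T \<theta> x))"
    using integrable_distr_eq[OF T f] integrable_density[OF \<rho>(3) \<rho>(1,2)]
    by (simp add: \<rho>_push[OF \<theta>] mult.commute)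
qed

lemma integrable_density_push:
  assumes "\<theta> \<in> \<Theta>"
  shows "integrable lborel (\<rho> \<theta>)"
  using integrable_push[OF assms, of "\<lambda>_. 1"] integrable_const_\<mu>[of 1] by simp

lemma integrable_test_function:
  assumes \<theta>: "\<theta> \<in> \<Theta>" and \<phi>: "\<phi> \<in> test_functions"
  shows "integrable \<mu> (\<lambda>x. \<phi> (T \<theta> x))" "integrable lborel (\<lambda>x. \<phi> x * \<rho> \<theta> x)"
proof -
  obtain M where M: "0 \<le> M" "\<And>x. norm (\<phi> x) \<le> M"
    using test_function_bounded[OF \<phi>] by blast
  show "integrable \<mu> (\<lambda>x. \<phi> (T \<theta> x))"
  proof (rule Bochner_Integration.integrable_bound[OF integrable_const_\<mu>[of M]])
    show "(\<lambda>x. \<phi> (T \<theta> x)) \<in> borel_measurable \<mu>"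
      using measurable_compose[OF T_measurable[OF \<theta>] test_function_measurable[OF \<phi>]] by simp
  qed (use M in auto)
  then show "integrable lborel (\<lambda>x. \<phi> x * \<rho> \<theta> x)"
    by (simp add: integrable_push[OF \<theta> test_function_measurable[OF \<phi>]])
qed

text \<open>By invariance of domain \<open>(\<theta>, x) \<mapsto> (\<theta>, T\<^sub>\<theta> x)\<close> is a homeomorphism, so for \<open>\<theta>\<close> in a compact
  ball the functions \<open>\<phi> \<circ> T\<^sub>\<theta>\<close> are all supported in one compact set.\<close>

lemma test_function_push_lipschitz:
  assumes \<theta>: "\<theta> \<in> \<Theta>" and \<phi>: "\<phi> \<in> test_functions"
  obtains r M where "0 < r" "ball \<theta> r \<subseteq> \<Theta>"
    "\<And>\<theta>' x. dist \<theta>' \<theta> < r \<Longrightarrow> \<bar>\<phi> (T \<theta>' x) - \<phi> (T \<theta> x)\<bar> \<le> M * norm (\<theta>' - \<theta>)"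
proof -
  obtain r where r: "0 < r" "cball \<theta> r \<subseteq> \<Theta>"
    using open_params \<theta> by (auto simp: open_contains_cball)
  define \<Phi> where "\<Phi> = (\<lambda>(\<theta>, x). (\<theta>, T \<theta> x))"
  have "\<Phi> ` (\<Theta> \<times> UNIV) = \<Theta> \<times> UNIV"
  proof (intro equalityI subsetI)
    fix z assume "z \<in> \<Theta> \<times> (UNIV :: 'a set)"
    \<comment> \<open>Surjectivity is fibrewise: each parameter slice is mapped onto itself by the
      bijection with that parameter.\<close>
    then have "z = \<Phi> (fst z, inv (T (fst z)) (snd z))"
      using T_bij by (auto simp: \<Phi>_def bij_is_surj surj_f_inv_f)
    then show "z \<in> \<Phi> ` (\<Theta> \<times> UNIV)"
      by (rule rev_image_eqI[rotated]) (use \<open>z \<in> \<Theta> \<times> UNIV\<close> in auto)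
  qed (auto simp: \<Phi>_def)
  moreover have "continuous_on (\<Theta> \<times> UNIV) \<Phi>"
    using smooth_on_continuous[OF T_smooth]
    unfolding \<Phi>_def case_prod_unfold
    by (intro continuous_on_Pair continuous_on_fst continuous_on_id)
  moreover have "inj_on \<Phi> (\<Theta> \<times> UNIV)"
  proof (rule inj_onI)
    fix z w assume "z \<in> \<Theta> \<times> UNIV" "\<Phi> z = \<Phi> w"
    then have "fst z \<in> \<Theta>" "fst z = fst w" "T (fst z) (snd z) = T (fst z) (snd w)"
      by (auto simp: \<Phi>_def case_prod_unfold)
    then show "z = w"
      using injD[OF bij_is_inj[OF T_bij]] by (simp add: prod_eq_iff)
  qed
  moreover have "open (\<Theta> \<times> (UNIV :: 'a set))"
    using open_params by (simp add: open_Times)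
  ultimately obtain g where g: "homeomorphism (\<Theta> \<times> UNIV) (\<Theta> \<times> UNIV) \<Phi> g"
    using invariance_of_domain_homeomorphism[of "\<Theta> \<times> UNIV" \<Phi>] by auto
  define B where "B = cball \<theta> r"
  define S where "S = closure {x. \<phi> x \<noteq> 0}"
  \<comment> \<open>\<open>K\<close> collects every point that some map with parameter in
    \<open>B\<close> sends into the support \<open>S\<close>.\<close>
  define K where "K = snd ` g ` (B \<times> S)"
  have "compact (B \<times> S)"
    using \<phi> by (auto simp: B_def S_def test_functions_def intro: compact_Times)
  moreover have "continuous_on (B \<times> S) g"
    using g r by (auto simp: homeomorphism_def B_def elim!: continuous_on_subset)
  ultimately have "compact K"
    unfolding K_def by (intro compact_continuous_image continuous_on_snd continuous_on_id)
  have zero: "\<phi> (T \<theta>' x) = 0" if "\<theta>' \<in> B" "x \<notin> K" for \<theta>' x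
  proof (rule ccontr)
    assume "\<phi> (T \<theta>' x) \<noteq> 0"
    then have "\<Phi> (\<theta>', x) \<in> B \<times> S"
      using that(1) closure_subset[of "{x. \<phi> x \<noteq> 0}"] by (auto simp: \<Phi>_def S_def)
    moreover have "g (\<Phi> (\<theta>', x)) = (\<theta>', x)"
      using g that(1) r by (auto simp: homeomorphism_def B_def)
    ultimately have "(\<theta>', x) \<in> g ` (B \<times> S)"
      by (metis image_eqI)
    then have "snd (\<theta>', x) \<in> K"
      unfolding K_def by (rule imageI)
    then show False
      using that(2) by simp
  qed
  have "compact (B \<times> K)" "B \<times> K \<subseteq> \<Theta> \<times> UNIV"
    using \<open>compact K\<close> r by (auto simp: B_def intro: compact_Times)
  then obtain M1 where M1: "0 \<le> M1"
    "\<And>z. z \<in> B \<times> K \<Longrightarrow> onorm (frechet_derivative (\<lambda>(\<theta>, x). T \<theta> x) (at z)) \<le> M1"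
    using smooth_on_derivative_bounded[OF T_smooth] by metis
  obtain M2 where M2: "0 \<le> M2" "\<And>x y. \<bar>\<phi> x - \<phi> y\<bar> \<le> M2 * norm (x - y)"
    using test_function_lipschitz[OF \<phi>] by metis
  \<comment> \<open>Off \<open>K\<close> both values vanish. On \<open>K\<close> the mean value
    inequality applies along the convex slice \<open>B \<times> {x}\<close>, where \<open>M1\<close>
    bounds the derivative of the family.\<close>
  have "\<bar>\<phi> (T \<theta>' x) - \<phi> (T \<theta> x)\<bar> \<le> (M2 * M1) * norm (\<theta>' - \<theta>)" if "dist \<theta>' \<theta> < r" for \<theta>' x
  proof (cases "x \<in> K")
    case True
    have in_B: "\<theta>' \<in> B" "\<theta> \<in> B"
      using that r by (auto simp: B_def dist_commute)
    have "norm ((\<lambda>(\<theta>, x). T \<theta> x) (\<theta>', x) - (\<lambda>(\<theta>, x). T \<theta> x) (\<theta>, x)) \<le> M1 * norm ((\<theta>', x) - (\<theta>, x))"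
    proof (rule differentiable_bound[where S="B \<times> {x}"])
      show "convex (B \<times> {x})"
        by (simp add: B_def convex_Times)
      fix z assume z: "z \<in> B \<times> {x}"
      then have "(\<lambda>(\<theta>, x). T \<theta> x) differentiable (at z)"
        using r by (intro smooth_on_differentiable[OF T_smooth]) (auto simp: B_def)
      then show "((\<lambda>(\<theta>, x). T \<theta> x) has_derivative frechet_derivative (\<lambda>(\<theta>, x). T \<theta> x) (at z)) (at z within B \<times> {x})"
        using frechet_derivative_works has_derivative_at_withinI by blast
      show "onorm (frechet_derivative (\<lambda>(\<theta>, x). T \<theta> x) (at z)) \<le> M1"
        using z True by (intro M1(2)) auto
    qed (use in_B in auto)
    then have "norm (T \<theta>' x - T \<theta> x) \<le> M1 * norm (\<theta>' - \<theta>)"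
      by simp
    then have "M2 * norm (T \<theta>' x - T \<theta> x) \<le> M2 * (M1 * norm (\<theta>' - \<theta>))"
      using M2(1) by (rule mult_left_mono)
    then show ?thesis
      using M2(2)[of "T \<theta>' x" "T \<theta> x"] by (simp add: mult.assoc)
  next
    case False
    then show ?thesis
      using zero[of \<theta>' x] zero[of \<theta> x] that r M1(1) M2(1) by (simp add: B_def dist_commute)
  qed
  moreover have "ball \<theta> r \<subseteq> \<Theta>"
    using r by auto
  ultimately show ?thesis
    using that[OF r(1)] by blast
qed

text \<open>For fixed \<open>x\<close> the integrand is differentiable by the chain rule. Its
  Lipschitz constant in the parameter does not depend on \<open>x\<close>, and constants are
  integrable for the finite measure \<open>\<mu>\<close>.\<close>

lemma integral_test_function_differentiable:
  assumes \<theta>: "\<theta> \<in> \<Theta>" and \<phi>: "\<phi> \<in> test_functions"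
  shows "(\<lambda>\<theta>. \<integral>x. \<phi> x * \<rho> \<theta> x \<partial>lborel) differentiable (at \<theta>)"
proof -
  obtain r M where r: "0 < r" "ball \<theta> r \<subseteq> \<Theta>"
    and M: "\<And>\<theta>' x. dist \<theta>' \<theta> < r \<Longrightarrow> \<bar>\<phi> (T \<theta>' x) - \<phi> (T \<theta> x)\<bar> \<le> M * norm (\<theta>' - \<theta>)"
    using test_function_push_lipschitz[OF \<theta> \<phi>] by metis
  have in_\<Theta>: "\<theta>' \<in> \<Theta>" if "dist \<theta>' \<theta> < r" for \<theta>'
    using that r by (auto simp: dist_commute)
  have diff: "(\<lambda>\<theta>. \<phi> (T \<theta> x)) differentiable (at \<theta>)" for x
  proof -
    have "(\<lambda>\<theta>. (\<theta>, x)) differentiable (at \<theta>)"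
      unfolding differentiable_def
      by (rule exI, rule has_derivative_Pair[OF has_derivative_ident has_derivative_const])
    moreover have "(\<lambda>(\<theta>, x). T \<theta> x) differentiable (at (\<theta>, x))"
      using \<theta> by (intro smooth_on_differentiable[OF T_smooth]) auto
    ultimately have "((\<lambda>(\<theta>, x). T \<theta> x) \<circ> (\<lambda>\<theta>. (\<theta>, x))) differentiable (at \<theta>)"
      by (intro differentiable_chain_at)
    from differentiable_chain_at[OF this test_function_differentiable[OF \<phi>]]
    show ?thesis by (simp add: comp_def)
  qed
  have "((\<lambda>\<theta>. \<integral>x. \<phi> (T \<theta> x) \<partial>\<mu>) has_derivative
      (\<lambda>h. \<integral>x. frechet_derivative (\<lambda>\<theta>. \<phi> (T \<theta> x)) (at \<theta>) h \<partial>\<mu>)) (at \<theta>)"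
  proof (rule has_derivative_integral[OF r(1)])
    show "integrable \<mu> (\<lambda>x. \<phi> (T \<theta>' x))" if "dist \<theta>' \<theta> < r" for \<theta>'
      by (rule integrable_test_function(1)[OF in_\<Theta>[OF that] \<phi>])
    show "integrable \<mu> (\<lambda>_. M)" by (rule integrable_const_\<mu>)
    show "\<bar>\<phi> (T \<theta>' x) - \<phi> (T \<theta> x)\<bar> \<le> M * norm (\<theta>' - \<theta>)" if "dist \<theta>' \<theta> < r" for \<theta>' x
      using that by (rule M)
    show "((\<lambda>\<theta>. \<phi> (T \<theta> x)) has_derivative frechet_derivative (\<lambda>\<theta>. \<phi> (T \<theta> x)) (at \<theta>)) (at \<theta>)" for x
      using diff by (simp add: frechet_derivative_works)
  qed
  then have "((\<lambda>\<theta>. \<integral>x. \<phi> x * \<rho> \<theta> x \<partial>lborel) has_derivative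
      (\<lambda>h. \<integral>x. frechet_derivative (\<lambda>\<theta>. \<phi> (T \<theta> x)) (at \<theta>) h \<partial>\<mu>)) (at \<theta>)"
    \<comment> \<open>The change of variables is available only for parameters in
      \<open>\<Theta>\<close>, which suffices because \<open>\<Theta>\<close> is open.\<close>
    by (rule has_derivative_transform_within_open[OF _ open_params \<theta>])
      (simp add: integral_push test_function_measurable[OF \<phi>])
  then show ?thesis
    by (auto simp: differentiable_def)
qed

text \<open>An explicit candidate for the definite description \<open>pushforward_tangent\<close>.
  The value zero off the test functions is the convention of
  \<open>test_functionals\<close>.\<close>

definition tangent :: "'p \<Rightarrow> 'p \<Rightarrow> ('a \<Rightarrow> real) \<Rightarrow> real" where
  "tangent \<theta> \<xi> \<phi> = (if \<phi> \<in> test_functions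
     then frechet_derivative (\<lambda>\<theta>. \<integral>x. \<phi> x * \<rho> \<theta> x \<partial>lborel) (at \<theta>) \<xi> else 0)"

lemma tangent_has_derivative:
  assumes "\<theta> \<in> \<Theta>" "\<phi> \<in> test_functions"
  shows "((\<lambda>\<theta>. \<integral>x. \<phi> x * \<rho> \<theta> x \<partial>lborel) has_derivative (\<lambda>\<xi>. tangent \<theta> \<xi> \<phi>)) (at \<theta>)"
  using integral_test_function_differentiable[OF assms] assms(2)
  by (simp add: tangent_def frechet_derivative_works)

text \<open>The integral is linear in the test function, and uniqueness of the Frechet derivative
  passes this on to the derivative.\<close>

lemma tangent_in_test_functionals:
  assumes \<theta>: "\<theta> \<in> \<Theta>"
  shows "tangent \<theta> \<xi> \<in> test_functionals"
  unfolding test_functionals_def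
proof (intro CollectI conjI ballI allI impI)
  fix \<phi> \<zeta> :: "'a \<Rightarrow> real" and a b :: real
  assume \<phi>: "\<phi> \<in> test_functions" and \<zeta>: "\<zeta> \<in> test_functions"
  have "((\<lambda>\<theta>. a * (\<integral>x. \<phi> x * \<rho> \<theta> x \<partial>lborel) + b * (\<integral>x. \<zeta> x * \<rho> \<theta> x \<partial>lborel)) has_derivative
      (\<lambda>\<xi>. a * tangent \<theta> \<xi> \<phi> + b * tangent \<theta> \<xi> \<zeta>)) (at \<theta>)"
    by (intro has_derivative_add has_derivative_mult_right tangent_has_derivative \<theta> \<phi> \<zeta>)
  then have "((\<lambda>\<theta>. \<integral>x. (a * \<phi> x + b * \<zeta> x) * \<rho> \<theta> x \<partial>lborel) has_derivative
      (\<lambda>\<xi>. a * tangent \<theta> \<xi> \<phi> + b * tangent \<theta> \<xi> \<zeta>)) (at \<theta>)"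
    by (rule has_derivative_transform_within_open[OF _ open_params \<theta>])
      (simp add: integrable_test_function \<phi> \<zeta> distrib_right mult.assoc)
  from has_derivative_unique[OF this tangent_has_derivative[OF \<theta> test_functions_linear_combination[OF \<phi> \<zeta>]]]
  show "tangent \<theta> \<xi> (\<lambda>x. a * \<phi> x + b * \<zeta> x) = a * tangent \<theta> \<xi> \<phi> + b * tangent \<theta> \<xi> \<zeta>"
    by (rule fun_cong[symmetric])
qed (simp add: tangent_def)

text \<open>The chain rule with a Frechet derivative in the parameter. The set \<open>S\<close> is
  arbitrary so that the one-sided derivative of the flow at time zero is covered.\<close>

lemma tangent_has_weak_derivative:
  assumes "(c has_vector_derivative \<xi>) (at t within S)" "c t \<in> \<Theta>"
  shows "has_weak_derivative (\<lambda>s. \<rho> (c s)) (tangent (c t) \<xi>) (at t within S)"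
  unfolding has_weak_derivative_def
proof (intro conjI ballI)
  fix \<phi> :: "'a \<Rightarrow> real" assume \<phi>: "\<phi> \<in> test_functions"
  note D = tangent_has_derivative[OF assms(2) \<phi>]
  have "((\<lambda>s. \<integral>x. \<phi> x * \<rho> (c s) x \<partial>lborel) has_derivative (\<lambda>h. tangent (c t) (h *\<^sub>R \<xi>) \<phi>)) (at t within S)"
    using assms(1) D unfolding has_vector_derivative_def by (rule has_derivative_compose)
  then show "((\<lambda>s. \<integral>x. \<phi> x * \<rho> (c s) x \<partial>lborel) has_real_derivative tangent (c t) \<xi> \<phi>) (at t within S)"
    by (simp add: has_field_derivative_def linear_cmul[OF has_derivative_linear[OF D]] mult_commute_abs)
qed (rule tangent_in_test_functionals[OF assms(2)])

text \<open>The chain rule shows that \<open>tangent\<close> satisfies the defining condition. For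
  uniqueness a single admissible curve is enough, namely a straight line.\<close>

lemma pushforward_tangent_eq:
  assumes \<theta>: "\<theta> \<in> \<Theta>"
  shows "pushforward_tangent \<Theta> \<rho> \<theta> \<xi> = tangent \<theta> \<xi>"
  unfolding pushforward_tangent_def
proof (rule the_equality)
  show "\<forall>c \<epsilon>. 0 < \<epsilon> \<and> (\<forall>t\<in>{- \<epsilon><..<\<epsilon>}. c t \<in> \<Theta> \<and> c differentiable at t) \<and> c 0 = \<theta>
      \<and> (c has_vector_derivative \<xi>) (at 0) \<longrightarrow> has_weak_derivative (\<lambda>t. \<rho> (c t)) (tangent \<theta> \<xi>) (at 0)"
    using tangent_has_weak_derivative[where t=0] \<theta> by auto
next
  fix D
  assume D: "\<forall>c \<epsilon>. 0 < \<epsilon> \<and> (\<forall>t\<in>{- \<epsilon><..<\<epsilon>}. c t \<in> \<Theta> \<and> c differentiable at t) \<and> c 0 = \<theta>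
      \<and> (c has_vector_derivative \<xi>) (at 0) \<longrightarrow> has_weak_derivative (\<lambda>t. \<rho> (c t)) D (at 0)"
  define c where "c t = \<theta> + t *\<^sub>R \<xi>" for t :: real
  have c': "(c has_vector_derivative \<xi>) (at t)" for t
    unfolding c_def by (auto intro!: derivative_eq_intros)
  have "isCont c 0"
    using c' has_vector_derivative_continuous by blast
  moreover have "c 0 = \<theta>"
    by (simp add: c_def)
  ultimately have "\<forall>\<^sub>F t in at 0. c t \<in> \<Theta>"
    using open_params \<theta> by (auto simp: isCont_def intro: topological_tendstoD)
  then obtain \<epsilon> where \<epsilon>: "0 < \<epsilon>" "\<And>t. t \<noteq> 0 \<Longrightarrow> dist t 0 < \<epsilon> \<Longrightarrow> c t \<in> \<Theta>"
    by (auto simp: eventually_at)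
  have "\<forall>t\<in>{- \<epsilon><..<\<epsilon>}. c t \<in> \<Theta> \<and> c differentiable at t"
  proof
    fix t assume t: "t \<in> {- \<epsilon><..<\<epsilon>}"
    then have "c t \<in> \<Theta>"
      \<comment> \<open>The filter \<open>at 0\<close> says nothing about \<open>t = 0\<close>
        itself, which is treated separately.\<close>
      using \<epsilon>(2)[of t] \<theta> \<open>c 0 = \<theta>\<close> by (cases "t = 0") auto
    then show "c t \<in> \<Theta> \<and> c differentiable at t"
      using c' differentiableI_vector by blast
  qed
  then have "has_weak_derivative (\<lambda>t. \<rho> (c t)) D (at 0)"
    using D \<epsilon>(1) c' \<open>c 0 = \<theta>\<close> by blast
  moreover have "has_weak_derivative (\<lambda>t. \<rho> (c t)) (tangent \<theta> \<xi>) (at 0)"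
    using tangent_has_weak_derivative[OF c', of 0] \<open>c 0 = \<theta>\<close> \<theta> by simp
  ultimately show "D = tangent \<theta> \<xi>"
    by (rule has_weak_derivative_unique)
qed

lemma tangent_linear_combination:
  assumes "\<theta> \<in> \<Theta>"
  shows "tangent \<theta> (a *\<^sub>R \<xi> + b *\<^sub>R \<eta>) \<phi> = a * tangent \<theta> \<xi> \<phi> + b * tangent \<theta> \<eta> \<phi>"
proof (cases "\<phi> \<in> test_functions")
  case True
  then have "linear (\<lambda>\<xi>. tangent \<theta> \<xi> \<phi>)"
    using tangent_has_derivative[OF assms] has_derivative_linear by blast
  from linear_add[OF this] linear_cmul[OF this] show ?thesis
    by simp
qed (simp add: tangent_def)

end

section \<open>The Wasserstein metric at a fixed density\<close>

locale weight =
  fixes \<rho> :: "'a::euclidean_space \<Rightarrow> real"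
  assumes weight_nonneg: "\<And>x. 0 \<le> \<rho> x"
    and weight_integrable: "integrable lborel \<rho>"
begin

lemma weight_measurable[measurable]: "\<rho> \<in> borel_measurable borel"
  using borel_measurable_integrable[OF weight_integrable] by simp

section \<open>Square-integrable vector fields for the weight\<close>

definition L2 :: "('a \<Rightarrow> 'a) \<Rightarrow> bool" where
  "L2 u \<longleftrightarrow> u \<in> borel_measurable borel \<and> integrable lborel (\<lambda>x. (norm (u x))\<^sup>2 * \<rho> x)"

text \<open>Fields are functions rather than classes, so this is only a semi-inner product: it does
  not see the set where the weight vanishes.\<close>

definition ip :: "('a \<Rightarrow> 'a) \<Rightarrow> ('a \<Rightarrow> 'a) \<Rightarrow> real" where
  "ip u v = (\<integral>x. (u x \<bullet> v x) * \<rho> x \<partial>lborel)"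

lemma L2_measurable[measurable_dest]: "L2 u \<Longrightarrow> u \<in> borel_measurable borel"
  by (simp add: L2_def)

lemma integrable_ip:
  assumes "L2 u" "L2 v"
  shows "integrable lborel (\<lambda>x. (u x \<bullet> v x) * \<rho> x)"
proof (rule Bochner_Integration.integrable_bound)
  note [measurable] = L2_measurable[OF assms(1)] L2_measurable[OF assms(2)]
  show "integrable lborel (\<lambda>x. (norm (u x))\<^sup>2 * \<rho> x + (norm (v x))\<^sup>2 * \<rho> x)"
    using assms by (simp add: L2_def)
  show "(\<lambda>x. (u x \<bullet> v x) * \<rho> x) \<in> borel_measurable lborel"
    by measurable
  show "AE x in lborel. norm ((u x \<bullet> v x) * \<rho> x) \<le> norm ((norm (u x))\<^sup>2 * \<rho> x + (norm (v x))\<^sup>2 * \<rho> x)"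
  proof (rule AE_I2)
    fix x
    have "\<bar>u x \<bullet> v x\<bar> \<le> norm (u x) * norm (v x)"
      by (rule Cauchy_Schwarz_ineq2)
    also have "\<dots> \<le> (norm (u x))\<^sup>2 + (norm (v x))\<^sup>2"
      using sum_squares_bound[of "norm (u x)" "norm (v x)"] mult_nonneg_nonneg[OF norm_ge_zero norm_ge_zero, of "u x" "v x"]
      by linarith
    finally have "\<bar>u x \<bullet> v x\<bar> * \<rho> x \<le> ((norm (u x))\<^sup>2 + (norm (v x))\<^sup>2) * \<rho> x"
      using weight_nonneg by (rule mult_right_mono)
    then show "norm ((u x \<bullet> v x) * \<rho> x) \<le> norm ((norm (u x))\<^sup>2 * \<rho> x + (norm (v x))\<^sup>2 * \<rho> x)"
      using weight_nonneg[of x] by (simp add: abs_mult distrib_right)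
  qed
qed

lemma L2_linear_combination:
  assumes "L2 u" "L2 v"
  shows "L2 (\<lambda>x. a *\<^sub>R u x + b *\<^sub>R v x)"
  unfolding L2_def
proof
  note [measurable] = L2_measurable[OF assms(1)] L2_measurable[OF assms(2)]
  show "(\<lambda>x. a *\<^sub>R u x + b *\<^sub>R v x) \<in> borel_measurable borel"
    by measurable
  have "(norm (a *\<^sub>R u x + b *\<^sub>R v x))\<^sup>2 * \<rho> x
      = a\<^sup>2 * ((u x \<bullet> u x) * \<rho> x) + 2 * a * b * ((u x \<bullet> v x) * \<rho> x) + b\<^sup>2 * ((v x \<bullet> v x) * \<rho> x)" for x
    unfolding power2_norm_eq_inner
    by (simp add: inner_commute power2_eq_square algebra_simps)
  then show "integrable lborel (\<lambda>x. (norm (a *\<^sub>R u x + b *\<^sub>R v x))\<^sup>2 * \<rho> x)"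
    using integrable_ip assms by simp
qed

lemma L2_diff:
  assumes "L2 u" "L2 v"
  shows "L2 (\<lambda>x. u x - v x)"
  using L2_linear_combination[OF assms, of 1 "-1"] by simp

lemma ip_commute: "ip u v = ip v u"
  by (simp add: ip_def inner_commute)

lemma ip_linear_combination:
  assumes "L2 u" "L2 v" "L2 w"
  shows "ip (\<lambda>x. a *\<^sub>R u x + b *\<^sub>R v x) w = a * ip u w + b * ip v w"
proof -
  have "((a *\<^sub>R u x + b *\<^sub>R v x) \<bullet> w x) * \<rho> x
      = a * ((u x \<bullet> w x) * \<rho> x) + b * ((v x \<bullet> w x) * \<rho> x)" for x
    by (simp add: algebra_simps)
  then show ?thesis
    using integrable_ip assms by (simp add: ip_def)
qed

lemma ip_self: "(\<integral>x. (norm (u x))\<^sup>2 * \<rho> x \<partial>lborel) = ip u u"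
  by (simp add: ip_def power2_norm_eq_inner)

lemma ip_self_nonneg: "0 \<le> ip u u"
  unfolding ip_def by (intro integral_nonneg_AE AE_I2 mult_nonneg_nonneg weight_nonneg inner_ge_zero)

text \<open>This expansion provides both the parallelogram estimate for approximating sequences and
  the distance estimate behind uniqueness.\<close>

lemma ip_linear_combination_self:
  assumes "L2 u" "L2 v"
  shows "ip (\<lambda>x. a *\<^sub>R u x + b *\<^sub>R v x) (\<lambda>x. a *\<^sub>R u x + b *\<^sub>R v x)
    = a\<^sup>2 * ip u u + 2 * a * b * ip u v + b\<^sup>2 * ip v v"
proof -
  let ?w = "\<lambda>x. a *\<^sub>R u x + b *\<^sub>R v x"
  have "L2 ?w" using assms by (rule L2_linear_combination)
  then have "ip ?w ?w = a * ip ?w u + b * ip ?w v"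
    using assms ip_linear_combination[of u v ?w a b] by (simp add: ip_commute)
  then show ?thesis
    using assms ip_linear_combination[of u v u a b] ip_linear_combination[of u v v a b]
      ip_commute[of v u]
    by (simp add: power2_eq_square algebra_simps)
qed

lemma test_gradient_L2:
  assumes "\<phi> \<in> test_functions"
  shows "L2 (gradient \<phi>)"
  unfolding L2_def
proof
  show meas[measurable]: "gradient \<phi> \<in> borel_measurable borel"
    using test_function_gradient_continuous[OF assms] by (rule borel_measurable_continuous_onI)
  obtain M where M: "0 \<le> M" "\<And>x. norm (gradient \<phi> x) \<le> M"
    using test_function_gradient_bounded[OF assms] by blast
  show "integrable lborel (\<lambda>x. (norm (gradient \<phi> x))\<^sup>2 * \<rho> x)"
  proof (rule Bochner_Integration.integrable_bound)
    show "integrable lborel (\<lambda>x. M\<^sup>2 * \<rho> x)"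
      using weight_integrable by simp
    show "AE x in lborel. norm ((norm (gradient \<phi> x))\<^sup>2 * \<rho> x) \<le> norm (M\<^sup>2 * \<rho> x)"
      using M weight_nonneg by (intro AE_I2) (simp add: abs_mult mult_right_mono power_mono)
  qed measurable
qed

section \<open>Potentials of finite energy\<close>

lemma finite_energy_gradient_L2:
  assumes "finite_energy_gradient \<rho> \<psi> u"
  shows "L2 u"
  using assms by (simp add: finite_energy_gradient_def L2_def)

text \<open>The same combination of the two approximating sequences works; its energy error is
  controlled by the two separate errors.\<close>

lemma finite_energy_gradient_linear_combination:
  assumes "finite_energy_gradient \<rho> \<psi> u" "finite_energy_gradient \<rho> \<psi>' v"
  shows "finite_energy_gradient \<rho> (\<lambda>x. a * \<psi> x + b * \<psi>' x) (\<lambda>x. a *\<^sub>R u x + b *\<^sub>R v x)"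
proof -
  have u: "L2 u" and v: "L2 v"
    using assms finite_energy_gradient_L2 by auto
  have [measurable]: "\<psi> \<in> borel_measurable borel" "\<psi>' \<in> borel_measurable borel"
    using assms by (auto simp: finite_energy_gradient_def)
  obtain \<phi> where \<phi>: "\<And>n. \<phi> n \<in> test_functions"
    "AE x in lborel. 0 < \<rho> x \<longrightarrow> (\<lambda>n. \<phi> n x) \<longlonglongrightarrow> \<psi> x"
    "(\<lambda>n. \<integral>x. (norm (gradient (\<phi> n) x - u x))\<^sup>2 * \<rho> x \<partial>lborel) \<longlonglongrightarrow> 0"
    using assms(1) unfolding finite_energy_gradient_def by blast
  obtain \<zeta> where \<zeta>: "\<And>n. \<zeta> n \<in> test_functions"
    "AE x in lborel. 0 < \<rho> x \<longrightarrow> (\<lambda>n. \<zeta> n x) \<longlonglongrightarrow> \<psi>' x"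
    "(\<lambda>n. \<integral>x. (norm (gradient (\<zeta> n) x - v x))\<^sup>2 * \<rho> x \<partial>lborel) \<longlonglongrightarrow> 0"
    using assms(2) unfolding finite_energy_gradient_def by blast
  define du dv where "du n x = gradient (\<phi> n) x - u x" and "dv n x = gradient (\<zeta> n) x - v x" for n x
  define \<omega> where "\<omega> n x = a * \<phi> n x + b * \<zeta> n x" for n x
  have L2: "L2 (du n)" "L2 (dv n)" for n
    unfolding du_def dv_def by (intro L2_diff test_gradient_L2 \<phi> \<zeta> u v)+
  have "(\<lambda>n. ip (\<lambda>x. a *\<^sub>R du n x + b *\<^sub>R dv n x) (\<lambda>x. a *\<^sub>R du n x + b *\<^sub>R dv n x)) \<longlonglongrightarrow> 0"
  proof (rule tendsto_sandwich[where f="\<lambda>_. 0"])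
    have parallelogram: "ip (\<lambda>x. a *\<^sub>R du n x + b *\<^sub>R dv n x) (\<lambda>x. a *\<^sub>R du n x + b *\<^sub>R dv n x)
        \<le> 2 * a\<^sup>2 * ip (du n) (du n) + 2 * b\<^sup>2 * ip (dv n) (dv n)" for n
      \<comment> \<open>Adding the expansions for \<open>b\<close> and \<open>- b\<close> cancels
        the cross terms, and the summand for \<open>- b\<close> is nonnegative.\<close>
      using ip_self_nonneg[of "\<lambda>x. a *\<^sub>R du n x + (- b) *\<^sub>R dv n x"]
        ip_linear_combination_self[OF L2, of a n b] ip_linear_combination_self[OF L2, of a n "- b"]
      by simp
    show "\<forall>\<^sub>F n in sequentially. ip (\<lambda>x. a *\<^sub>R du n x + b *\<^sub>R dv n x) (\<lambda>x. a *\<^sub>R du n x + b *\<^sub>R dv n x)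
        \<le> 2 * a\<^sup>2 * ip (du n) (du n) + 2 * b\<^sup>2 * ip (dv n) (dv n)"
      by (rule always_eventually, rule allI, rule parallelogram)
    have "(\<lambda>n. 2 * a\<^sup>2 * ip (du n) (du n) + 2 * b\<^sup>2 * ip (dv n) (dv n)) \<longlonglongrightarrow> 2 * a\<^sup>2 * 0 + 2 * b\<^sup>2 * 0"
      using \<phi>(3) \<zeta>(3) unfolding ip_self[of "du _", symmetric] ip_self[of "dv _", symmetric] du_def dv_def
      by (intro tendsto_intros)
    then show "(\<lambda>n. 2 * a\<^sup>2 * ip (du n) (du n) + 2 * b\<^sup>2 * ip (dv n) (dv n)) \<longlonglongrightarrow> 0"
      by simp
  qed (simp_all add: ip_self_nonneg)
  moreover have "gradient (\<omega> n) x - (a *\<^sub>R u x + b *\<^sub>R v x) = a *\<^sub>R du n x + b *\<^sub>R dv n x" for n x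
    unfolding \<omega>_def gradient_linear_combination[OF \<phi>(1) \<zeta>(1)]
    by (simp add: du_def dv_def algebra_simps)
  ultimately have "(\<lambda>n. \<integral>x. (norm (gradient (\<omega> n) x - (a *\<^sub>R u x + b *\<^sub>R v x)))\<^sup>2 * \<rho> x \<partial>lborel) \<longlonglongrightarrow> 0"
    by (simp add: ip_self)
  moreover have "\<omega> n \<in> test_functions" for n
    unfolding \<omega>_def by (intro test_functions_linear_combination \<phi> \<zeta>)
  moreover have "AE x in lborel. 0 < \<rho> x \<longrightarrow> (\<lambda>n. \<omega> n x) \<longlonglongrightarrow> a * \<psi> x + b * \<psi>' x"
    using \<phi>(2) \<zeta>(2) unfolding \<omega>_def by eventually_elim (auto intro!: tendsto_intros)
  moreover have "(\<lambda>x. a * \<psi> x + b * \<psi>' x) \<in> borel_measurable borel"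
    by measurable
  ultimately show ?thesis
    using L2_linear_combination[OF u v, of a b] unfolding finite_energy_gradient_def L2_def by blast
qed

lemma wasserstein_potential_L2:
  assumes "wasserstein_potential \<rho> D \<psi> u"
  shows "L2 u"
  using assms finite_energy_gradient_L2 by (auto simp: wasserstein_potential_def)

lemma wasserstein_potential_linear_combination:
  assumes "wasserstein_potential \<rho> D \<psi> u" "wasserstein_potential \<rho> E \<psi>' v"
  shows "wasserstein_potential \<rho> (\<lambda>\<phi>. a * D \<phi> + b * E \<phi>)
    (\<lambda>x. a * \<psi> x + b * \<psi>' x) (\<lambda>x. a *\<^sub>R u x + b *\<^sub>R v x)"
  unfolding wasserstein_potential_def
proof (intro conjI ballI)
  show "finite_energy_gradient \<rho> (\<lambda>x. a * \<psi> x + b * \<psi>' x) (\<lambda>x. a *\<^sub>R u x + b *\<^sub>R v x)"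
    using assms finite_energy_gradient_linear_combination unfolding wasserstein_potential_def by blast
  fix \<phi> :: "'a \<Rightarrow> real" assume \<phi>: "\<phi> \<in> test_functions"
  have "ip (\<lambda>x. a *\<^sub>R u x + b *\<^sub>R v x) (gradient \<phi>) = a * ip u (gradient \<phi>) + b * ip v (gradient \<phi>)"
    using assms by (intro ip_linear_combination test_gradient_L2 \<phi>) (auto intro: wasserstein_potential_L2)
  then have "ip (gradient \<phi>) (\<lambda>x. a *\<^sub>R u x + b *\<^sub>R v x) = a * ip (gradient \<phi>) u + b * ip (gradient \<phi>) v"
    by (simp add: ip_commute[of _ "gradient \<phi>"])
  then show "a * D \<phi> + b * E \<phi> = (\<integral>x. (gradient \<phi> x \<bullet> (a *\<^sub>R u x + b *\<^sub>R v x)) * \<rho> x \<partial>lborel)"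
    using assms \<phi> by (simp add: wasserstein_potential_def ip_def)
qed

text \<open>A weak solution of \<open>\<nabla>\<cdot>(\<rho> u) = 0\<close> is orthogonal to all \<open>\<nabla>\<phi>\<close>, while \<open>u\<close> is a limit of such
  gradients.\<close>

lemma wasserstein_potential_zero:
  assumes "wasserstein_potential \<rho> (\<lambda>_. 0) \<psi> u"
  shows "AE x in lborel. 0 < \<rho> x \<longrightarrow> u x = 0"
proof -
  have u: "L2 u"
    using assms by (rule wasserstein_potential_L2)
  obtain \<phi> where \<phi>: "\<And>n. \<phi> n \<in> test_functions"
    "(\<lambda>n. \<integral>x. (norm (gradient (\<phi> n) x - u x))\<^sup>2 * \<rho> x \<partial>lborel) \<longlonglongrightarrow> 0"
    using assms unfolding wasserstein_potential_def finite_energy_gradient_def by blast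
  \<comment> \<open>Pythagoras: the cross term vanishes by orthogonality, and the energy of the test
    gradient is nonnegative.\<close>
  have "ip u u \<le> (\<integral>x. (norm (gradient (\<phi> n) x - u x))\<^sup>2 * \<rho> x \<partial>lborel)" for n
  proof -
    have "ip (gradient (\<phi> n)) u = 0"
      using assms \<phi>(1) by (simp add: wasserstein_potential_def ip_def)
    then show ?thesis
      using ip_linear_combination_self[OF test_gradient_L2[OF \<phi>(1)] u, of 1 n "-1"] ip_self_nonneg
      by (simp add: ip_self)
  qed
  then have "ip u u \<le> 0"
    using \<phi>(2) by (intro LIMSEQ_le_const) auto
  then have "ip u u = 0"
    using ip_self_nonneg[of u] by simp
  then have "AE x in lborel. (norm (u x))\<^sup>2 * \<rho> x = 0"
    using u unfolding ip_self[symmetric] L2_def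
    by (subst (asm) integral_nonneg_eq_0_iff_AE) (auto simp: weight_nonneg)
  then show ?thesis
    by eventually_elim auto
qed

text \<open>Two potentials of one functional differ by a potential of the zero functional, so their
  gradients agree almost everywhere where the weight is positive. This makes the definite
  description well-defined.\<close>

lemma wasserstein_metric_eq:
  assumes "wasserstein_potential \<rho> D \<psi> u" "wasserstein_potential \<rho> E \<psi>' v"
  shows "wasserstein_metric \<rho> D E = ip u v"
  unfolding wasserstein_metric_def
proof (rule the_equality)
  show "\<exists>\<psi>1 u1 \<psi>2 u2. wasserstein_potential \<rho> D \<psi>1 u1 \<and> wasserstein_potential \<rho> E \<psi>2 u2
      \<and> ip u v = (\<integral>x. (u1 x \<bullet> u2 x) * \<rho> x \<partial>lborel)"
    using assms unfolding ip_def by blast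
next
  have unique: "AE x in lborel. 0 < \<rho> x \<longrightarrow> w x = w' x"
    if "wasserstein_potential \<rho> D' \<psi>1 w" "wasserstein_potential \<rho> D' \<psi>2 w'" for D' \<psi>1 \<psi>2 w w'
    using wasserstein_potential_zero[of _ "\<lambda>x. 1 *\<^sub>R w x + (-1) *\<^sub>R w' x"]
      wasserstein_potential_linear_combination[OF that, of 1 "-1"]
    by simp
  fix c
  assume "\<exists>\<psi>1 u1 \<psi>2 u2. wasserstein_potential \<rho> D \<psi>1 u1 \<and> wasserstein_potential \<rho> E \<psi>2 u2
      \<and> c = (\<integral>x. (u1 x \<bullet> u2 x) * \<rho> x \<partial>lborel)"
  then obtain \<psi>1 u1 \<psi>2 u2 where *: "wasserstein_potential \<rho> D \<psi>1 u1" "wasserstein_potential \<rho> E \<psi>2 u2"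
    and c: "c = ip u1 u2"
    by (auto simp: ip_def)
  note [measurable] = assms[THEN wasserstein_potential_L2, THEN L2_measurable]
    *[THEN wasserstein_potential_L2, THEN L2_measurable]
  \<comment> \<open>Where the weight is zero both sides vanish, whatever the gradients are
    there.\<close>
  have "AE x in lborel. (u1 x \<bullet> u2 x) * \<rho> x = (u x \<bullet> v x) * \<rho> x"
    using unique[OF *(1) assms(1)] unique[OF *(2) assms(2)]
  proof eventually_elim
    case (elim x)
    then show ?case using weight_nonneg[of x] by (cases "\<rho> x = 0") auto
  qed
  then show "c = ip u v"
    unfolding c ip_def by (intro integral_cong_AE) measurable
qed

lemma wasserstein_metric_commute:
  assumes "D \<in> wasserstein_tangent_space \<rho>" "E \<in> wasserstein_tangent_space \<rho>"
  shows "wasserstein_metric \<rho> D E = wasserstein_metric \<rho> E D"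
proof -
  obtain \<psi> u \<psi>' v where "wasserstein_potential \<rho> D \<psi> u" "wasserstein_potential \<rho> E \<psi>' v"
    using assms unfolding wasserstein_tangent_space_def by blast
  then show ?thesis
    by (simp add: wasserstein_metric_eq[of D \<psi> u] wasserstein_metric_eq[of E \<psi>' v] ip_commute)
qed

lemma wasserstein_metric_linear_combination:
  assumes "D \<in> wasserstein_tangent_space \<rho>" "D' \<in> wasserstein_tangent_space \<rho>"
    "E \<in> wasserstein_tangent_space \<rho>"
  shows "wasserstein_metric \<rho> (\<lambda>\<phi>. a * D \<phi> + b * D' \<phi>) E
    = a * wasserstein_metric \<rho> D E + b * wasserstein_metric \<rho> D' E"
proof -
  obtain \<psi> u \<psi>' u' \<omega> v where *: "wasserstein_potential \<rho> D \<psi> u"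
    "wasserstein_potential \<rho> D' \<psi>' u'" "wasserstein_potential \<rho> E \<omega> v"
    using assms unfolding wasserstein_tangent_space_def by blast
  show ?thesis
    unfolding wasserstein_metric_eq[OF wasserstein_potential_linear_combination[OF *(1,2)] *(3)]
      wasserstein_metric_eq[OF *(1,3)] wasserstein_metric_eq[OF *(2,3)]
    by (intro ip_linear_combination *[THEN wasserstein_potential_L2])
qed

end

section \<open>Gradients on the submanifold\<close>

lemma bilinear_matrix_representation:
  fixes f :: "real^'m \<Rightarrow> real^'m \<Rightarrow> real"
  assumes "bilinear f"
  shows "f x y = x \<bullet> ((\<chi> i j. f (axis i 1) (axis j 1)) *v y)"
proof -
  have "f x y = f (\<Sum>i\<in>UNIV. x $ i *\<^sub>R axis i 1) (\<Sum>j\<in>UNIV. y $ j *\<^sub>R axis j 1)"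
    using basis_expansion[of x] basis_expansion[of y] by (simp add: scalar_mult_eq_scaleR)
  also have "\<dots> = (\<Sum>i\<in>UNIV. \<Sum>j\<in>UNIV. x $ i * (f (axis i 1) (axis j 1) * y $ j))"
    by (simp add: bilinear_sum[OF assms] bilinear_lmul[OF assms] bilinear_rmul[OF assms]
        sum.cartesian_product mult.commute mult.left_commute)
  finally show ?thesis
    by (simp add: inner_vec_def matrix_vector_mult_def sum_distrib_left)
qed

lemma matrix_inv_vector_iff:
  fixes A :: "real^'n^'n"
  assumes "invertible A"
  shows "A *v x = b \<longleftrightarrow> x = matrix_inv A *v b"
proof -
  have "A ** matrix_inv A = mat 1 \<and> matrix_inv A ** A = mat 1"
    using assms unfolding invertible_def matrix_inv_def by (rule someI_ex)
  then show ?thesis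
    by (metis matrix_vector_mul_assoc matrix_vector_mul_lid)
qed

lemma (in pushforward_family) weight_push: "\<theta> \<in> \<Theta> \<Longrightarrow> weight (\<rho> \<theta>)"
  by unfold_locales (simp_all add: \<rho>_nonneg integrable_density_push)

text \<open>Linearity in the first argument combines linearity of the tangent vector in the velocity
  with that of the metric. Symmetry transfers it to the second argument.\<close>

lemma (in pushforward_family) bilinear_pullback_metric:
  assumes \<theta>: "\<theta> \<in> \<Theta>"
    and immersion: "\<And>\<xi>. pushforward_tangent \<Theta> \<rho> \<theta> \<xi> \<in> wasserstein_tangent_space (\<rho> \<theta>)"
  shows "bilinear (pullback_metric \<Theta> \<rho> \<theta>)"
proof -
  interpret weight "\<rho> \<theta>" by (rule weight_push[OF \<theta>])
  let ?P = "pushforward_tangent \<Theta> \<rho> \<theta>"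
  have "?P (a *\<^sub>R \<xi> + b *\<^sub>R \<eta>) = (\<lambda>\<phi>. a * ?P \<xi> \<phi> + b * ?P \<eta> \<phi>)" for a b \<xi> \<eta>
    by (simp add: fun_eq_iff pushforward_tangent_eq[OF \<theta>] tangent_linear_combination[OF \<theta>])
  then have comb: "pullback_metric \<Theta> \<rho> \<theta> (a *\<^sub>R \<xi> + b *\<^sub>R \<xi>') \<eta>
      = a * pullback_metric \<Theta> \<rho> \<theta> \<xi> \<eta> + b * pullback_metric \<Theta> \<rho> \<theta> \<xi>' \<eta>" for a b \<xi> \<xi>' \<eta>
    by (simp add: pullback_metric_def wasserstein_metric_linear_combination immersion)
  have lin: "linear (\<lambda>\<xi>. pullback_metric \<Theta> \<rho> \<theta> \<xi> \<eta>)" for \<eta>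
  proof (rule linearI)
    show "pullback_metric \<Theta> \<rho> \<theta> (\<xi> + \<xi>') \<eta>
        = pullback_metric \<Theta> \<rho> \<theta> \<xi> \<eta> + pullback_metric \<Theta> \<rho> \<theta> \<xi>' \<eta>" for \<xi> \<xi>'
      using comb[of 1 \<xi> 1] by simp
    show "pullback_metric \<Theta> \<rho> \<theta> (a *\<^sub>R \<xi>) \<eta> = a *\<^sub>R pullback_metric \<Theta> \<rho> \<theta> \<xi> \<eta>" for a \<xi>
      using comb[of a \<xi> 0] by simp
  qed
  have "(\<lambda>\<eta>. pullback_metric \<Theta> \<rho> \<theta> \<eta> \<xi>) = pullback_metric \<Theta> \<rho> \<theta> \<xi>" for \<xi>
    unfolding pullback_metric_def by (intro ext wasserstein_metric_commute immersion)
  then have "linear (pullback_metric \<Theta> \<rho> \<theta> \<xi>)" for \<xi>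
    using lin[of \<xi>] by simp
  with lin show ?thesis
    by (simp add: bilinear_def)
qed

text \<open>Stating this as an equivalence yields existence and uniqueness of the gradient together
  with its formula.\<close>

lemma is_submanifold_gradient_iff:
  fixes \<Theta> :: "(real^'m) set" and T :: "real^'m \<Rightarrow> real^'d \<Rightarrow> real^'d"
  assumes fam: "pushforward_family \<Theta> T p \<rho>" and \<theta>: "\<theta> \<in> \<Theta>"
    and immersion: "\<And>\<xi>. pushforward_tangent \<Theta> \<rho> \<theta> \<xi> \<in> wasserstein_tangent_space (\<rho> \<theta>)"
    and inv: "invertible (metric_matrix \<Theta> \<rho> \<theta>)"
    and diff: "(\<lambda>\<theta>. E (\<rho> \<theta>)) differentiable (at \<theta>)"
  shows "is_submanifold_gradient \<Theta> \<rho> E \<theta> \<eta> \<longleftrightarrow> \<eta> = pushforward_tangent \<Theta> \<rho> \<theta>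
    (matrix_inv (metric_matrix \<Theta> \<rho> \<theta>) *v gradient (\<lambda>\<theta>. E (\<rho> \<theta>)) \<theta>)"
proof -
  interpret pushforward_family \<Theta> T p \<rho> by (rule fam)
  let ?P = "pushforward_tangent \<Theta> \<rho> \<theta>" and ?G = "metric_matrix \<Theta> \<rho> \<theta>"
  let ?D = "gradient (\<lambda>\<theta>. E (\<rho> \<theta>)) \<theta>"
  interpret weight "\<rho> \<theta>" by (rule weight_push[OF \<theta>])
  have metric: "wasserstein_metric (\<rho> \<theta>) (?P \<zeta>) (?P \<xi>) = \<xi> \<bullet> (?G *v \<zeta>)" for \<zeta> \<xi>
  proof -
    \<comment> \<open>Symmetry puts the arguments in the order in which the matrix acts on
      \<open>\<zeta>\<close>.\<close>
    have "wasserstein_metric (\<rho> \<theta>) (?P \<zeta>) (?P \<xi>) = pullback_metric \<Theta> \<rho> \<theta> \<xi> \<zeta>"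
      unfolding pullback_metric_def by (intro wasserstein_metric_commute immersion)
    also have "\<dots> = \<xi> \<bullet> (?G *v \<zeta>)"
      unfolding metric_matrix_def
      by (intro bilinear_matrix_representation bilinear_pullback_metric \<theta> immersion)
    finally show ?thesis .
  qed
  have dE: "((\<lambda>s. E (\<rho> (\<theta> + s *\<^sub>R \<xi>))) has_real_derivative \<xi> \<bullet> ?D) (at 0)" for \<xi>
  proof -
    have "((\<lambda>s. \<theta> + s *\<^sub>R \<xi>) has_derivative (\<lambda>s. s *\<^sub>R \<xi>)) (at 0)"
      by (auto intro!: derivative_eq_intros)
    moreover have "((\<lambda>\<theta>. E (\<rho> \<theta>)) has_derivative (\<lambda>h. h \<bullet> ?D)) (at (\<theta> + 0 *\<^sub>R \<xi>))"
      using GDERIV_gradient[OF diff] by (simp add: gderiv_def)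
    ultimately have "((\<lambda>s. E (\<rho> (\<theta> + s *\<^sub>R \<xi>))) has_derivative (\<lambda>s. s *\<^sub>R \<xi> \<bullet> ?D)) (at 0)"
      by (rule has_derivative_compose)
    then show ?thesis
      by (simp add: has_field_derivative_def mult_commute_abs)
  qed
  have iff: "is_submanifold_gradient \<Theta> \<rho> E \<theta> (?P \<zeta>) \<longleftrightarrow> ?G *v \<zeta> = ?D" for \<zeta>
  proof -
    have "is_submanifold_gradient \<Theta> \<rho> E \<theta> (?P \<zeta>) \<longleftrightarrow>
        (\<forall>\<xi>. ((\<lambda>s. E (\<rho> (\<theta> + s *\<^sub>R \<xi>))) has_real_derivative \<xi> \<bullet> (?G *v \<zeta>)) (at 0))"
      by (simp add: is_submanifold_gradient_def submanifold_tangent_space_def metric)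
    also have "\<dots> \<longleftrightarrow> (\<forall>\<xi>. \<xi> \<bullet> (?G *v \<zeta>) = \<xi> \<bullet> ?D)"
      using dE DERIV_unique by metis
    also have "\<dots> \<longleftrightarrow> ?G *v \<zeta> = ?D"
      by (rule vector_eq_ldot)
    finally show ?thesis .
  qed
  \<comment> \<open>A gradient is tangent to the submanifold, so it comes from some velocity
    \<open>\<zeta>\<close>; invertibility of the matrix then determines this velocity.\<close>
  have "is_submanifold_gradient \<Theta> \<rho> E \<theta> \<eta> \<longleftrightarrow> (\<exists>\<zeta>. \<eta> = ?P \<zeta> \<and> is_submanifold_gradient \<Theta> \<rho> E \<theta> (?P \<zeta>))"
    unfolding is_submanifold_gradient_def submanifold_tangent_space_def by blast
  then show ?thesis
    by (simp add: iff matrix_inv_vector_iff[OF inv])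
qed

theorem theorem3:
  fixes \<Theta> :: "(real^'m) set"
    and T :: "real^'m \<Rightarrow> real^'d \<Rightarrow> real^'d"
    and p :: "real^'d \<Rightarrow> real"
    and \<rho> :: "real^'m \<Rightarrow> real^'d \<Rightarrow> real"
    and V :: "real^'d \<Rightarrow> real"
    and \<beta> :: real
    and \<gamma> :: "real \<Rightarrow> real^'m"
  assumes "open \<Theta>"
    and T_bij: "\<And>\<theta>. \<theta> \<in> \<Theta> \<Longrightarrow> bij (T \<theta>)"
    and T_smooth: "smooth_on (\<Theta> \<times> UNIV) (\<lambda>(\<theta>, x). T \<theta> x)"
    and p_density: "p \<in> prob_densities"
    and p_pos: "\<And>x. 0 < p x"
    and T_moment: "\<And>\<theta>. \<theta> \<in> \<Theta> \<Longrightarrow>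
          integrable (density lborel (\<lambda>x. ennreal (p x))) (\<lambda>x. (norm (T \<theta> x))\<^sup>2)"
    and \<rho>_meas: "\<And>\<theta>. \<theta> \<in> \<Theta> \<Longrightarrow> \<rho> \<theta> \<in> borel_measurable borel"
    and \<rho>_nonneg: "\<And>\<theta> x. \<theta> \<in> \<Theta> \<Longrightarrow> 0 \<le> \<rho> \<theta> x"
    and \<rho>_push: "\<And>\<theta>. \<theta> \<in> \<Theta> \<Longrightarrow>
          distr (density lborel (\<lambda>x. ennreal (p x))) borel (T \<theta>) = density lborel (\<lambda>x. ennreal (\<rho> \<theta> x))"
    and immersion: "\<And>\<theta> \<xi>. \<theta> \<in> \<Theta> \<Longrightarrow>
          pushforward_tangent \<Theta> \<rho> \<theta> \<xi> \<in> wasserstein_tangent_space (\<rho> \<theta>)"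
    and G_invertible: "\<And>\<theta>. \<theta> \<in> \<Theta> \<Longrightarrow> invertible (metric_matrix \<Theta> \<rho> \<theta>)"
    and "\<beta> > 0"
    and V_finite: "\<And>\<theta>. \<theta> \<in> \<Theta> \<Longrightarrow> integrable lborel (\<lambda>x. V x * \<rho> \<theta> x)"
    and entropy_finite: "\<And>\<theta>. \<theta> \<in> \<Theta> \<Longrightarrow> integrable lborel (\<lambda>x. \<rho> \<theta> x * ln (\<rho> \<theta> x))"
    and F_differentiable: "\<And>\<theta>. \<theta> \<in> \<Theta> \<Longrightarrow>
          (\<lambda>\<theta>. relative_entropy V \<beta> (\<rho> \<theta>)) differentiable (at \<theta>)"
    and \<gamma>_in: "\<And>t. 0 \<le> t \<Longrightarrow> \<gamma> t \<in> \<Theta>"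
    and \<gamma>_ode: "\<And>t. 0 \<le> t \<Longrightarrow>
          (\<gamma> has_vector_derivative
             - (matrix_inv (metric_matrix \<Theta> \<rho> (\<gamma> t))
                  *v gradient (\<lambda>\<theta>. relative_entropy V \<beta> (\<rho> \<theta>)) (\<gamma> t)))
            (at t within {0..})"
  shows "\<forall>t\<ge>0. (\<exists>!\<eta>. is_submanifold_gradient \<Theta> \<rho> (relative_entropy V \<beta>) (\<gamma> t) \<eta>)
    \<and> has_weak_derivative (\<lambda>s. \<rho> (\<gamma> s))
        (\<lambda>\<phi>. - submanifold_gradient \<Theta> \<rho> (relative_entropy V \<beta>) (\<gamma> t) \<phi>)
        (at t within {0..})"
proof (intro allI impI)
  fix t :: real assume t: "0 \<le> t"
  interpret pushforward_family \<Theta> T p \<rho>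
    by (rule pushforward_family.intro) fact+
  let ?E = "relative_entropy V \<beta>" and ?P = "pushforward_tangent \<Theta> \<rho> (\<gamma> t)"
  let ?\<zeta> = "matrix_inv (metric_matrix \<Theta> \<rho> (\<gamma> t)) *v gradient (\<lambda>\<theta>. ?E (\<rho> \<theta>)) (\<gamma> t)"
  have \<gamma>t: "\<gamma> t \<in> \<Theta>"
    using \<gamma>_in t by simp
  have grad: "is_submanifold_gradient \<Theta> \<rho> ?E (\<gamma> t) \<eta> \<longleftrightarrow> \<eta> = ?P ?\<zeta>" for \<eta>
    by (rule is_submanifold_gradient_iff[OF pushforward_family_axioms \<gamma>t immersion[OF \<gamma>t]
          G_invertible[OF \<gamma>t] F_differentiable[OF \<gamma>t]])
  have "submanifold_gradient \<Theta> \<rho> ?E (\<gamma> t) = ?P ?\<zeta>"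
    unfolding submanifold_gradient_def grad by (rule the_eq_trivial)
  \<comment> \<open>The minus sign of the equation in parameter space becomes the minus sign of the
    gradient flow.\<close>
  moreover have "?P (- ?\<zeta>) = (\<lambda>\<phi>. - ?P ?\<zeta> \<phi>)"
    using tangent_linear_combination[OF \<gamma>t, of "- 1" ?\<zeta> 0 0]
    by (simp add: pushforward_tangent_eq[OF \<gamma>t] fun_eq_iff)
  moreover have "has_weak_derivative (\<lambda>s. \<rho> (\<gamma> s)) (?P (- ?\<zeta>)) (at t within {0..})"
    unfolding pushforward_tangent_eq[OF \<gamma>t]
    by (rule tangent_has_weak_derivative[where c=\<gamma>, OF \<gamma>_ode[OF t] \<gamma>t])
  ultimately show "(\<exists>!\<eta>. is_submanifold_gradient \<Theta> \<rho> ?E (\<gamma> t) \<eta>)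
      \<and> has_weak_derivative (\<lambda>s. \<rho> (\<gamma> s))
          (\<lambda>\<phi>. - submanifold_gradient \<Theta> \<rho> ?E (\<gamma> t) \<phi>) (at t within {0..})"
    by (simp add: grad)
qed

end
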